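(* Let $\Gamma$ be a countably infinite discrete group, let $k \in \mathbb{N}^+$, and let $\mathscr{P}$ be a finite set of $k$-patterns. The following statements are equivalent. (1) There is a continuous $\mathscr{P}$-avoiding $k$-coloring of $\mathrm{Free}(2^\Gamma)$. (2) Every free zero-dimensional Polish $\Gamma$-space admits a continuous $\mathscr{P}$-avoiding $k$-coloring.
   Context: $k$ is identified with the discrete set $\{0,\ldots,k-1\}$; a $k$-coloring of a set is a function from it to $k$. A $\Gamma$-space is a topological space $X$ with a continuous left action $\Gamma \curvearrowright X$. It is free if the action is free, and zero-dimensional Polish if the underlying space is Polish and has a base of clopen sets. The product space $2^\Gamma$ is a $\Gamma$-space under the action $(\gamma \cdot x)(\delta) = x(\delta\gamma)$. Its free part $\mathrm{Free}(2^\Gamma)$ is the set of all points with trivial stabilizer, with the subspace topology and induced action. A $k$-pattern is a partial map $p \colon \Gamma \rightharpoonup k$ with finite domain. A $k$-pattern $p$ occurs in a coloring $f \colon X \to k$ of a $\Gamma$-space $X$ if there is $x \in X$ such that $f(\gamma \cdot x) = p(\gamma)$ for all $\gamma \in \mathrm{dom}(p)$. The coloring $f$ is $\mathscr{P}$-avoiding if no $p \in \mathscr{P}$ occurs in $f$. *)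

theory Defs
  imports "HOL-Analysis.Analysis" "HOL-Algebra.Group_Action"
begin

definition zero_dimensional_space :: "'x topology \<Rightarrow> bool" where
  "zero_dimensional_space X \<longleftrightarrow>
     (\<exists>\<B>. (\<forall>U\<in>\<B>. openin X U \<and> closedin X U) \<and>
          openin X = arbitrary union_of (\<lambda>U. U \<in> \<B>))"

definition Polish_space :: "'x topology \<Rightarrow> bool" where
  "Polish_space X \<longleftrightarrow> separable_space X \<and> completely_metrizable_space X"

(* The acting group carries the discrete topology.  The library's group actions are by
   functions that are extensional on the underlying set; this only normalises the
   irrelevant values outside of it. *)
definition gamma_space ::
    "('g, 'm) monoid_scheme \<Rightarrow> 'x topology \<Rightarrow> ('g \<Rightarrow> 'x \<Rightarrow> 'x) \<Rightarrow> bool" where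
  "gamma_space G X \<phi> \<longleftrightarrow>
     group_action G (topspace X) \<phi> \<and>
     continuous_map (prod_topology (discrete_topology (carrier G)) X) X (\<lambda>(g, x). \<phi> g x)"

definition free_action_on ::
    "('g, 'm) monoid_scheme \<Rightarrow> 'x set \<Rightarrow> ('g \<Rightarrow> 'x \<Rightarrow> 'x) \<Rightarrow> bool" where
  "free_action_on G E \<phi> \<longleftrightarrow> (\<forall>x\<in>E. stabilizer G \<phi> x = {\<one>\<^bsub>G\<^esub>})"

definition shift_space :: "('g, 'm) monoid_scheme \<Rightarrow> ('g \<Rightarrow> nat) topology" where
  "shift_space G = product_topology (\<lambda>_. discrete_topology {..<2}) (carrier G)"

definition shift_action ::
    "('g, 'm) monoid_scheme \<Rightarrow> 'g \<Rightarrow> ('g \<Rightarrow> nat) \<Rightarrow> ('g \<Rightarrow> nat)" where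
  "shift_action G \<gamma> =
     (\<lambda>x\<in>topspace (shift_space G). \<lambda>\<delta>\<in>carrier G. x (\<delta> \<otimes>\<^bsub>G\<^esub> \<gamma>))"

definition free_part :: "('g, 'm) monoid_scheme \<Rightarrow> ('g \<Rightarrow> nat) set" where
  "free_part G =
     {x \<in> topspace (shift_space G). stabilizer G (shift_action G) x = {\<one>\<^bsub>G\<^esub>}}"

definition free_part_space :: "('g, 'm) monoid_scheme \<Rightarrow> ('g \<Rightarrow> nat) topology" where
  "free_part_space G = subtopology (shift_space G) (free_part G)"

definition free_part_action ::
    "('g, 'm) monoid_scheme \<Rightarrow> 'g \<Rightarrow> ('g \<Rightarrow> nat) \<Rightarrow> ('g \<Rightarrow> nat)" where
  "free_part_action G \<gamma> = restrict (shift_action G \<gamma>) (free_part G)"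

definition is_pattern ::
    "('g, 'm) monoid_scheme \<Rightarrow> nat \<Rightarrow> ('g \<rightharpoonup> nat) \<Rightarrow> bool" where
  "is_pattern G k p \<longleftrightarrow> finite (dom p) \<and> dom p \<subseteq> carrier G \<and> ran p \<subseteq> {..<k}"

definition occurs_in ::
    "('g \<rightharpoonup> nat) \<Rightarrow> 'x topology \<Rightarrow> ('g \<Rightarrow> 'x \<Rightarrow> 'x) \<Rightarrow> ('x \<Rightarrow> nat) \<Rightarrow> bool" where
  "occurs_in p X \<phi> f \<longleftrightarrow>
     (\<exists>x\<in>topspace X. \<forall>\<gamma>\<in>dom p. p \<gamma> = Some (f (\<phi> \<gamma> x)))"

definition avoiding ::
    "('g \<rightharpoonup> nat) set \<Rightarrow> 'x topology \<Rightarrow> ('g \<Rightarrow> 'x \<Rightarrow> 'x) \<Rightarrow> ('x \<Rightarrow> nat) \<Rightarrow> bool" where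
  "avoiding P X \<phi> f \<longleftrightarrow> (\<forall>p\<in>P. \<not> occurs_in p X \<phi> f)"

definition admits_continuous_avoiding_coloring ::
    "nat \<Rightarrow> ('g \<rightharpoonup> nat) set \<Rightarrow> 'x topology \<Rightarrow> ('g \<Rightarrow> 'x \<Rightarrow> 'x) \<Rightarrow> bool" where
  "admits_continuous_avoiding_coloring k P X \<phi> \<longleftrightarrow>
     (\<exists>f. continuous_map X (discrete_topology {..<k}) f \<and> avoiding P X \<phi> f)"

(* The type argument fixes where the points of the spaces live; the underlying set of a space
   is an arbitrary subset of that type.  A Polish space has at most continuum many points, so
   the instance TYPE(real) ranges over all Polish spaces up to homeomorphism. *)
definition all_free_zd_Polish_spaces_admit ::
    "'x itself \<Rightarrow> ('g, 'm) monoid_scheme \<Rightarrow> nat \<Rightarrow> ('g \<rightharpoonup> nat) set \<Rightarrow> bool" where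
  "all_free_zd_Polish_spaces_admit _ G k P \<longleftrightarrow>
     (\<forall>(X :: 'x topology) \<phi>.
        gamma_space G X \<phi> \<longrightarrow> free_action_on G (topspace X) \<phi> \<longrightarrow>
        zero_dimensional_space X \<longrightarrow> Polish_space X \<longrightarrow>
        admits_continuous_avoiding_coloring k P X \<phi>)"

end

theory Submission
  imports Defs "HOL-Real_Asymp.Real_Asymp"
begin

text \<open>
The direction from all spaces to \<open>Free(2^\<Gamma>)\<close> is formal: the free part is itself a free
zero-dimensional Polish space, being a \<open>G_delta\<close> set in a Cantor space
(\<open>Polish_space_free_part\<close>), and an injection of its points into the reals transports it to the
required type (\<open>admits_free_part_if_all_real\<close>).

For the converse, let \<open>f\<close> be a continuous avoiding coloring of the free part and \<open>X\<close> a free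
zero-dimensional Polish space. A continuous two-coloring \<open>c\<close> of \<open>X\<close> induces an equivariant map to
the shift, sending \<open>x\<close> to \<open>\<delta> \<mapsto> c (\<delta> \<cdot> x)\<close>, but in general no \<open>c\<close> makes it land in the free part: on an
odometer every such map has periodic values. It is enough, however, to come close to the free part.
Enumerate the elements \<open>\<gamma> n\<close> of \<open>\<Gamma> - {1}\<close>, and suppose there are finite windows \<open>D n\<close>, depending on \<open>\<Gamma>\<close>
only, such that for every \<open>N\<close> each \<open>X\<close> has a continuous \<open>c\<close> with the following property: for all
\<open>n < N\<close> and all \<open>x\<close>, some \<open>d \<in> D n\<close> satisfies \<open>c (d \<gamma>_n \<cdot> x) \<noteq> c (d \<cdot> x)\<close>. The points of the shift whose
whole orbit satisfies all of these requirements form a compact subset of the free part. There \<open>f\<close>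
extends to a continuous coloring of the entire shift, and by compactness finitely many
requirements already exclude the finitely many forbidden patterns. The map induced by a coloring \<open>c\<close>
for these requirements pulls the extension back to \<open>X\<close> (\<open>admits_if_admits_free_part\<close>).

The windows come from a stage by stage construction (\<open>uniform_separating_colorings\<close>). The points
still uncolored form a clopen set \<open>B\<close> that is met by every orbit within bounded distance. A stage
selects a much sparser set \<open>A\<close> inside \<open>B\<close>, also of bounded gaps, and colors \<open>B - A\<close> such that the
pattern around each \<open>a \<in> A\<close> differs from its translates by the relevant conjugates of \<open>\<gamma> n\<close>. The pool
of free positions around \<open>a\<close> has more than \<open>6 r\<close> elements, hence exponentially many patterns,
while the gaps of \<open>A\<close>, and so the number of constraints, are polynomial in \<open>r\<close>. This is
the setting of the local lemma, but it can be solved greedily: every constraint involves at most two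
pools, and it is charged to the one with enough control, so that each pool can be filled in
knowing only the earlier ones (\<open>separating_coloring_step\<close>). Greedy choices along a continuous
rank are continuous (\<open>greedy_labelling\<close>).
\<close>

section \<open>Locally constant maps and greedy choices\<close>

abbreviation locally_constant :: "'x topology \<Rightarrow> ('x \<Rightarrow> 'b) \<Rightarrow> bool" where
  "locally_constant X f \<equiv> continuous_map X (discrete_topology UNIV) f"

lemma locally_constant_iff:
  "locally_constant X f \<longleftrightarrow> (\<forall>w. openin X {x \<in> topspace X. f x = w})"
proof
  assume f: "locally_constant X f"
  show "\<forall>w. openin X {x \<in> topspace X. f x = w}"
  proof
    fix w
    show "openin X {x \<in> topspace X. f x = w}"
      using openin_continuous_map_preimage[OF f, of "{w}"] by simp
  qed
next
  assume R: "\<forall>w. openin X {x \<in> topspace X. f x = w}"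
  have "openin X {x \<in> topspace X. f x \<in> U}" for U
  proof -
    have "{x \<in> topspace X. f x \<in> U} = (\<Union>w\<in>U. {x \<in> topspace X. f x = w})" by auto
    with R show ?thesis by auto
  qed
  then show "locally_constant X f" by (simp add: continuous_map_def)
qed

lemma locally_constant_cong:
  assumes "locally_constant X f" "\<And>x. x \<in> topspace X \<Longrightarrow> f x = g x"
  shows "locally_constant X g"
  using continuous_map_eq[OF assms] .

lemma locally_constant_const: "locally_constant X (\<lambda>x. c)"
  by simp

text \<open>Closure under case distinction on a locally constant value, even one with infinitely many values. The
closure properties below follow from it, so every relation assembled from locally constant data
by finitely many quantifiers is again clopen. This is how continuity is verified throughout.\<close>

lemma locally_constant_bind:
  assumes i: "locally_constant X i" and F: "\<And>n. locally_constant X (F n)"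
  shows "locally_constant X (\<lambda>x. F (i x) x)"
  unfolding locally_constant_iff
proof
  fix w
  have "{x \<in> topspace X. F (i x) x = w}
      = (\<Union>n. {x \<in> topspace X. i x = n} \<inter> {x \<in> topspace X. F n x = w})" by auto
  moreover have "openin X ({x \<in> topspace X. i x = n} \<inter> {x \<in> topspace X. F n x = w})" for n
    using i F unfolding locally_constant_iff by (intro openin_Int) auto
  ultimately show "openin X {x \<in> topspace X. F (i x) x = w}" by auto
qed

lemma locally_constant_comp:
  assumes "locally_constant X f"
  shows "locally_constant X (\<lambda>x. h (f x))"
  using locally_constant_bind[OF assms, of "\<lambda>a x. h a"] by simp

lemma locally_constant_comp2:
  assumes "locally_constant X f" "locally_constant X g"
  shows "locally_constant X (\<lambda>x. h (f x) (g x))"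
  using locally_constant_bind[OF assms(1), of "\<lambda>a x. h a (g x)"] locally_constant_comp[OF assms(2)]
  by blast

lemma locally_constant_Collect:
  assumes "finite T" and "\<And>t. t \<in> T \<Longrightarrow> locally_constant X (P t)"
  shows "locally_constant X (\<lambda>x. {t \<in> T. P t x})"
  using assms
proof (induction T rule: finite_induct)
  case (insert a T)
  have "locally_constant X (\<lambda>x. (if P a x then insert a else id) {t \<in> T. P t x})"
    by (rule locally_constant_comp2[where h="\<lambda>b S. (if b then insert a else id) S"])
      (use insert in auto)
  then show ?case
    by (rule locally_constant_cong) auto
qed simp

lemma locally_constant_Ball:
  assumes "finite T" and "\<And>t. t \<in> T \<Longrightarrow> locally_constant X (P t)"
  shows "locally_constant X (\<lambda>x. \<forall>t\<in>T. P t x)"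
  using locally_constant_comp[OF locally_constant_Collect[OF assms], where h="\<lambda>S. S = T"]
  by (rule locally_constant_cong) auto

lemma locally_constant_Bex:
  assumes "finite T" and "\<And>t. t \<in> T \<Longrightarrow> locally_constant X (P t)"
  shows "locally_constant X (\<lambda>x. \<exists>t\<in>T. P t x)"
  using locally_constant_comp[OF locally_constant_Collect[OF assms], where h="\<lambda>S. S \<noteq> {}"]
  by (rule locally_constant_cong) auto

lemma locally_constant_clopen:
  "locally_constant X (\<lambda>x. x \<in> U) \<longleftrightarrow> openin X (topspace X \<inter> U) \<and> closedin X (topspace X \<inter> U)"
proof -
  have 1: "{x \<in> topspace X. (x \<in> U) = True} = topspace X \<inter> U" by auto
  have 2: "{x \<in> topspace X. (x \<in> U) = False} = topspace X - (topspace X \<inter> U)" by auto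
  show ?thesis
    unfolding locally_constant_iff all_bool_eq 1 2 closedin_def by auto
qed

lemma locally_constant_Least:
  fixes P :: "nat \<Rightarrow> 'x \<Rightarrow> bool"
  assumes P: "\<And>n. locally_constant X (P n)"
    and ex: "\<And>x. x \<in> topspace X \<Longrightarrow> \<exists>n. P n x"
  shows "locally_constant X (\<lambda>x. LEAST n. P n x)"
  unfolding locally_constant_iff
proof
  fix m
  have *: "(LEAST n. P n x) = m \<longleftrightarrow> P m x \<and> (\<forall>k\<in>{..<m}. \<not> P k x)" if "x \<in> topspace X" for x
    using ex[OF that]
    by (metis LeastI_ex Least_equality lessThan_iff not_less not_less_Least)
  have "locally_constant X (\<lambda>x. P m x \<and> (\<forall>k\<in>{..<m}. \<not> P k x))"
    by (intro locally_constant_comp2[where h="(\<and>)"] P locally_constant_Ball locally_constant_comp[where h=Not]) auto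
  then have "openin X {x \<in> topspace X. (P m x \<and> (\<forall>k\<in>{..<m}. \<not> P k x)) = True}"
    unfolding locally_constant_iff by blast
  moreover have "{x \<in> topspace X. (P m x \<and> (\<forall>k\<in>{..<m}. \<not> P k x)) = True}
      = {x \<in> topspace X. (LEAST n. P n x) = m}"
    using * by auto
  ultimately show "openin X {x \<in> topspace X. (LEAST n. P n x) = m}" by simp
qed

lemma locally_constant_simple:
  "locally_constant X f \<Longrightarrow> locally_constant X (\<lambda>x. \<not> f x)"
  "locally_constant X f \<Longrightarrow> locally_constant X g \<Longrightarrow> locally_constant X (\<lambda>x. f x \<and> g x)"
  "locally_constant X f \<Longrightarrow> locally_constant X g \<Longrightarrow> locally_constant X (\<lambda>x. f x \<longrightarrow> g x)"
  "locally_constant X f \<Longrightarrow> locally_constant X g \<Longrightarrow> locally_constant X (\<lambda>x. f x \<longleftrightarrow> g x)"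
  by (rule locally_constant_comp locally_constant_comp2; assumption)+

lemma locally_constant_less:
  fixes f g :: "'x \<Rightarrow> nat"
  shows "locally_constant X f \<Longrightarrow> locally_constant X g \<Longrightarrow> locally_constant X (\<lambda>x. f x < g x)"
  by (rule locally_constant_comp2)

lemma locally_constant_mem:
  "locally_constant X S \<Longrightarrow> locally_constant X (\<lambda>x. c \<in> S x)"
  by (rule locally_constant_comp)

lemma locally_constant_if:
  "locally_constant X b \<Longrightarrow> locally_constant X f \<Longrightarrow> locally_constant X g \<Longrightarrow>
   locally_constant X (\<lambda>x. if b x then f x else g x)"
  by (rule locally_constant_bind[where F="\<lambda>b x. if b then f x else g x"]) auto

lemma zero_dimensional_space_clopen_nbhd:
  assumes "zero_dimensional_space X" "openin X U" "x \<in> U"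
  obtains V where "openin X V" "closedin X V" "x \<in> V" "V \<subseteq> U"
proof -
  obtain \<B> where B: "\<And>U. U \<in> \<B> \<Longrightarrow> openin X U \<and> closedin X U"
    and eq: "openin X = arbitrary union_of (\<lambda>U. U \<in> \<B>)"
    using assms(1) unfolding zero_dimensional_space_def by blast
  have "(arbitrary union_of (\<lambda>U. U \<in> \<B>)) U" using assms(2) eq by simp
  then obtain \<U> where "\<U> \<subseteq> \<B>" "\<Union>\<U> = U" unfolding union_of_def by auto
  with assms(3) B that show ?thesis by blast
qed

text \<open>A property that small neighborhoods of each point have, and that passes to smaller sets, holds on
the members of a clopen cover which can be indexed continuously by \<open>nat\<close>: a countable clopen cover
exists by the Lindelof property, and a point is sent to the first member that contains it.\<close>

lemma clopen_indexing:
  assumes zd: "zero_dimensional_space X" and L: "Lindelof_space X"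
    and ex: "\<And>x. x \<in> topspace X \<Longrightarrow> \<exists>U. openin X U \<and> x \<in> U \<and> R U"
    and mono: "\<And>U V. R U \<Longrightarrow> V \<subseteq> U \<Longrightarrow> R V"
  obtains i :: "'x \<Rightarrow> nat" and U :: "nat \<Rightarrow> 'x set"
  where "locally_constant X i" "\<And>x. x \<in> topspace X \<Longrightarrow> x \<in> U (i x) \<and> R (U (i x))"
proof (cases "topspace X = {}")
  case True
  show ?thesis
    by (rule that[of "\<lambda>x. 0" "\<lambda>n. {}"]) (use True in auto)
next
  case False
  define \<U> where "\<U> = {U. openin X U \<and> closedin X U \<and> R U}"
  have "\<exists>U\<in>\<U>. x \<in> U" if "x \<in> topspace X" for x
  proof -
    obtain U where U: "openin X U" "x \<in> U" "R U" using ex[OF \<open>x \<in> topspace X\<close>] by blast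
    obtain V where "openin X V" "closedin X V" "x \<in> V" "V \<subseteq> U"
      by (rule zero_dimensional_space_clopen_nbhd[OF zd U(1,2)])
    then show ?thesis
      using mono[OF U(3)] unfolding \<U>_def by blast
  qed
  then have "topspace X \<subseteq> \<Union>\<U>" by blast
  then obtain \<V> where V: "countable \<V>" "\<V> \<subseteq> \<U>" "topspace X \<subseteq> \<Union>\<V>"
    using L unfolding Lindelof_space_alt \<U>_def by (metis (no_types, lifting) mem_Collect_eq)
  with False have "\<V> \<noteq> {}" by auto
  define U where "U = from_nat_into \<V>"
  have rU: "range U = \<V>"
    using V(1) \<open>\<V> \<noteq> {}\<close> unfolding U_def by (rule range_from_nat_into[rotated])
  have inU: "U n \<in> \<U>" for n using rU V(2) by blast
  have exn: "\<exists>n. x \<in> U n" if "x \<in> topspace X" for x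
    using that V(3) rU by (metis UnionE rangeE subsetD)
  show ?thesis
  proof (rule that[of "\<lambda>x. LEAST n. x \<in> U n" U])
    have "locally_constant X (\<lambda>x. x \<in> U n)" for n
      using inU[of n] unfolding locally_constant_clopen \<U>_def
      by (auto simp: Int_absorb1 openin_subset)
    then show "locally_constant X (\<lambda>x. LEAST n. x \<in> U n)"
      by (rule locally_constant_Least) (use exn in auto)
    show "x \<in> U (LEAST n. x \<in> U n) \<and> R (U (LEAST n. x \<in> U n))" if "x \<in> topspace X" for x
      using LeastI_ex[OF exn[OF that]] inU unfolding \<U>_def by auto
  qed
qed

text \<open>Continuous greedy construction. A point chooses its label when its rank is reached, subject to a
constraint that sees only labels of points of smaller rank. A point is treated after finitely many
rounds, and the least admissible label of an enumeration is chosen, so each choice depends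
continuously on the point. Infinitely many ranks are harmless, because each rank class is open.\<close>

lemma greedy_labelling:
  fixes rank :: "'x \<Rightarrow> nat" and Good :: "('x \<Rightarrow> 'w) \<Rightarrow> 'x \<Rightarrow> 'w \<Rightarrow> bool"
  assumes rank: "locally_constant X rank"
    and lc: "\<And>f w. locally_constant X f \<Longrightarrow> locally_constant X (\<lambda>x. Good f x w)"
    and loc: "\<And>f f' x. x \<in> topspace X \<Longrightarrow>
                (\<And>y. y \<in> topspace X \<Longrightarrow> rank y < rank x \<Longrightarrow> f y = f' y) \<Longrightarrow> Good f x = Good f' x"
    and W: "countable W"
    and ex: "\<And>f x. x \<in> topspace X \<Longrightarrow> \<exists>w\<in>W. Good f x w"
  obtains L where "locally_constant X L" "\<And>x. x \<in> topspace X \<Longrightarrow> Good L x (L x)"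
proof -
  define e where "e = from_nat_into W"
  have exn: "\<exists>n. Good f x (e n)" if "x \<in> topspace X" for f x
    using ex[OF that, of f] W unfolding e_def by (metis from_nat_into_surj)
  define pick where "pick = (\<lambda>f x. e (LEAST n. Good f x (e n)))"
  have pick: "Good f x (pick f x)" if "x \<in> topspace X" for f x
    using LeastI_ex[OF exn[OF that, of f]] unfolding pick_def .
  have lcpick: "locally_constant X (pick f)" if "locally_constant X f" for f
    unfolding pick_def
    by (intro locally_constant_comp[where h=e] locally_constant_Least lc that) (use exn in auto)
  have locpick: "pick f x = pick f' x"
    if "x \<in> topspace X" "\<And>y. y \<in> topspace X \<Longrightarrow> rank y < rank x \<Longrightarrow> f y = f' y" for f f' x
    unfolding pick_def using loc[OF that(1), of f f'] that(2) by simp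
  \<comment> \<open>\<open>A n\<close> is the labelling after the ranks below \<open>n\<close> have been treated.\<close>
  define A where "A = rec_nat (\<lambda>x. undefined) (\<lambda>n f x. if rank x = n then pick f x else f x)"
  have A0: "A 0 = (\<lambda>x. undefined)" and
    ASuc: "A (Suc n) = (\<lambda>x. if rank x = n then pick (A n) x else A n x)" for n
    unfolding A_def by simp_all
  have lcA: "locally_constant X (A n)" for n
  proof (induction n)
    case 0
    then show ?case by (simp add: A0)
  next
    case (Suc n)
    have "locally_constant X (\<lambda>x. (if rank x = n then fst else snd) (pick (A n) x, A n x))"
      by (intro locally_constant_comp2[where h="\<lambda>r. if r = n then fst else snd"]
          locally_constant_comp2[where h="\<lambda>r p. (if r = n then fst else snd) p"]
          locally_constant_comp2[where h=Pair] rank lcpick Suc)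
    then show ?case unfolding ASuc by (rule locally_constant_cong) auto
  qed
  define L where "L = (\<lambda>x. pick (A (rank x)) x)"
  have AL: "A n y = L y" if "rank y < n" for n y
    using that
  proof (induction n)
    case (Suc n)
    then show ?case by (cases "rank y = n") (auto simp: ASuc L_def)
  qed simp
  show ?thesis
  proof
    show "locally_constant X L"
      unfolding L_def by (rule locally_constant_bind[OF rank]) (rule lcpick[OF lcA])
    show "Good L x (L x)" if x: "x \<in> topspace X" for x
    proof -
      have "L x = pick L x"
        unfolding L_def[THEN fun_cong, of x] by (rule locpick[OF x]) (rule AL)
      with pick[OF x, of L] show ?thesis by simp
    qed
  qed
qed

section \<open>Counting patterns\<close>

text \<open>Union bound without probabilities. If a bad subset of \<open>Q\<close> is determined by what it does off \<open>R\<close>, then at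
most a \<open>2 ^ - card R\<close> fraction of all subsets is bad; fewer than \<open>2 ^ r\<close> bad events with
\<open>card R \<ge> r\<close> therefore cannot exhaust the power set.\<close>

lemma exists_subset_avoiding:
  fixes Bad :: "'i \<Rightarrow> 'a set \<Rightarrow> bool"
  assumes Q: "finite Q" and I: "finite I" "card I < 2 ^ r"
    and off: "\<And>i. i \<in> I \<Longrightarrow> \<exists>R\<subseteq>Q. r \<le> card R \<and> inj_on (\<lambda>w. w - R) {w. w \<subseteq> Q \<and> Bad i w}"
  shows "\<exists>w\<subseteq>Q. \<forall>i\<in>I. \<not> Bad i w"
proof (rule ccontr)
  assume neg: "\<not> ?thesis"
  define N where "N i = {w. w \<subseteq> Q \<and> Bad i w}" for i
  have card_N: "card (N i) * 2 ^ r \<le> 2 ^ card Q" if "i \<in> I" for i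
  proof -
    obtain R where R: "R \<subseteq> Q" "r \<le> card R" "inj_on (\<lambda>w. w - R) (N i)"
      using off[OF \<open>i \<in> I\<close>] unfolding N_def by blast
    have "card (N i) \<le> card (Pow (Q - R))"
      by (rule card_inj_on_le[OF R(3)]) (use Q in \<open>auto simp: N_def\<close>)
    also have "\<dots> = 2 ^ (card Q - card R)"
      using Q R(1) by (simp add: card_Pow card_Diff_subset finite_subset)
    finally have "card (N i) * 2 ^ card R \<le> 2 ^ (card Q - card R) * 2 ^ card R" by simp
    also have "\<dots> = 2 ^ card Q"
      using card_mono[OF Q R(1)] by (simp flip: power_add)
    finally have "card (N i) * 2 ^ card R \<le> 2 ^ card Q" .
    moreover have "card (N i) * 2 ^ r \<le> card (N i) * 2 ^ card R"
      using R(2) by (simp add: power_increasing)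
    ultimately show ?thesis by linarith
  qed
  have "Pow Q \<subseteq> (\<Union>i\<in>I. N i)" using neg unfolding N_def by blast
  then have "card (Pow Q) \<le> card (\<Union>i\<in>I. N i)"
    by (rule card_mono[rotated]) (use Q I in \<open>auto simp: N_def\<close>)
  also have "\<dots> \<le> (\<Sum>i\<in>I. card (N i))" using I(1) by (rule card_UN_le)
  finally have "2 ^ card Q * 2 ^ r \<le> (\<Sum>i\<in>I. card (N i)) * 2 ^ r"
    using Q by (simp add: card_Pow)
  also have "\<dots> = (\<Sum>i\<in>I. card (N i) * 2 ^ r)" by (simp add: sum_distrib_right)
  also have "\<dots> \<le> (\<Sum>i\<in>I. 2 ^ card Q)" using card_N by (rule sum_mono)
  also have "\<dots> = card I * 2 ^ card Q" by simp
  also have "\<dots> < 2 ^ r * 2 ^ card Q" using I(2) by simp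
  finally show False by (simp add: mult.commute)
qed

lemma exponential_beats_power:
  fixes e :: nat
  shows "\<exists>r. 4 * e * ((6 * r + 2) * e) ^ 6 < 2 ^ r"
proof (cases "e = 0")
  case False
  define c where "c = real e"
  have "c > 0" using False by (simp add: c_def)
  then have "eventually (\<lambda>r::nat. 4 * c * ((6 * real r + 2) * c) ^ 6 < 2 ^ r) at_top"
    by real_asymp
  then obtain r where r: "4 * c * ((6 * real r + 2) * c) ^ 6 < 2 ^ r"
    using eventually_happens sequentially_bot by blast
  have "4 * c * ((6 * real r + 2) * c) ^ 6 = real (4 * e * ((6 * r + 2) * e) ^ 6)"
    by (simp add: c_def algebra_simps)
  with r have "real (4 * e * ((6 * r + 2) * e) ^ 6) < real (2 ^ r)" by simp
  then show ?thesis using of_nat_less_iff by blast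
qed simp

context group
begin

text \<open>In an infinite group there are \<open>m\<close> pairwise disjoint translates \<open>E \<otimes> h\<close>, and a set \<open>Y\<close> that meets
every translate of \<open>E\<close> contains a point of each. The size of the union is linear in \<open>m\<close>; this is
what makes exponentially many patterns outnumber polynomially many constraints later.\<close>

lemma exists_thick_set:
  assumes inf: "infinite (carrier G)" and E: "finite E" "E \<subseteq> carrier G"
  shows "\<exists>T. finite T \<and> T \<subseteq> carrier G \<and> card T \<le> m * card E \<and>
           (\<forall>Y. (\<forall>x\<in>carrier G. \<exists>d\<in>E. d \<otimes> x \<in> Y) \<longrightarrow> m \<le> card {t \<in> T. t \<in> Y})"
proof (induction m)
  case 0
  then show ?case by (intro exI[of _ "{}"]) auto
next
  case (Suc m)
  then obtain T where T: "finite T" "T \<subseteq> carrier G" "card T \<le> m * card E"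
    and Y: "\<And>Y. (\<forall>x\<in>carrier G. \<exists>d\<in>E. d \<otimes> x \<in> Y) \<Longrightarrow> m \<le> card {t \<in> T. t \<in> Y}"
    by blast
  have "finite ((\<lambda>(d, t). inv d \<otimes> t) ` (E \<times> T))" using T E by auto
  then obtain h where h: "h \<in> carrier G" "h \<notin> (\<lambda>(d, t). inv d \<otimes> t) ` (E \<times> T)"
    using inf by (meson finite_subset subsetI)
  have new: "d \<otimes> h \<notin> T" if "d \<in> E" for d
  proof
    assume "d \<otimes> h \<in> T"
    moreover have "h = inv d \<otimes> (d \<otimes> h)"
      using that E h(1) by (simp add: m_assoc[symmetric] subset_eq)
    ultimately show False using h(2) that by (metis (no_types, lifting) SigmaI case_prod_conv image_eqI)
  qed
  show ?case
  proof (intro exI[of _ "T \<union> (\<lambda>d. d \<otimes> h) ` E"] conjI allI impI)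
    show "finite (T \<union> (\<lambda>d. d \<otimes> h) ` E)" using T E by auto
    show "T \<union> (\<lambda>d. d \<otimes> h) ` E \<subseteq> carrier G" using T E h by auto
    have "card (T \<union> (\<lambda>d. d \<otimes> h) ` E) \<le> card T + card ((\<lambda>d. d \<otimes> h) ` E)" by (rule card_Un_le)
    also have "\<dots> \<le> m * card E + card E" using T(3) card_image_le[OF E(1)] by (rule add_mono)
    finally show "card (T \<union> (\<lambda>d. d \<otimes> h) ` E) \<le> Suc m * card E" by simp
    fix Y assume syn: "\<forall>x\<in>carrier G. \<exists>d\<in>E. d \<otimes> x \<in> Y"
    then obtain d where d: "d \<in> E" "d \<otimes> h \<in> Y" using h(1) by blast
    have "Suc m \<le> Suc (card {t \<in> T. t \<in> Y})" using Y[OF syn] by simp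
    also have "\<dots> = card (insert (d \<otimes> h) {t \<in> T. t \<in> Y})" using T(1) new[OF d(1)] by simp
    also have "\<dots> \<le> card {t \<in> T \<union> (\<lambda>d. d \<otimes> h) ` E. t \<in> Y}"
      by (rule card_mono) (use T E d in auto)
    finally show "Suc m \<le> card {t \<in> T \<union> (\<lambda>d. d \<otimes> h) ` E. t \<in> Y}" .
  qed
qed

text \<open>The constraint of a pattern with its own translate is circular: the target value at \<open>x\<close> is the
value at \<open>x \<otimes> g\<close>. On a subset of a third of the size that is disjoint from its translate the
targets are determined by the values off the subset. A maximal such subset works.\<close>

lemma exists_translate_independent_subset:
  assumes N: "finite N" "N \<subseteq> carrier G" and g: "g \<in> carrier G" "g \<noteq> \<one>"
  obtains R where "R \<subseteq> N" "card N \<le> 3 * card R" "\<And>x. x \<in> R \<Longrightarrow> x \<otimes> g \<notin> R"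
proof -
  define \<R> where "\<R> = {R. R \<subseteq> N \<and> (\<forall>x\<in>R. x \<otimes> g \<notin> R)}"
  have "finite \<R>" "{} \<in> \<R>" using N(1) by (auto simp: \<R>_def)
  then obtain R where R: "R \<in> \<R>" and max: "\<And>R'. R' \<in> \<R> \<Longrightarrow> R \<subseteq> R' \<Longrightarrow> R = R'"
    by (metis finite_has_maximal empty_iff)
  have RN: "R \<subseteq> N" and Rg: "\<And>x. x \<in> R \<Longrightarrow> x \<otimes> g \<notin> R" using R by (auto simp: \<R>_def)
  have "N \<subseteq> R \<union> ((\<lambda>x. x \<otimes> inv g) ` R \<union> (\<lambda>x. x \<otimes> g) ` R)"
  proof
    fix x assume x: "x \<in> N"
    show "x \<in> R \<union> ((\<lambda>x. x \<otimes> inv g) ` R \<union> (\<lambda>x. x \<otimes> g) ` R)"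
    proof (rule ccontr)
      assume not: "\<not> ?thesis"
      have xG: "x \<in> carrier G" using x N by auto
      have "x \<otimes> g \<noteq> x" using xG g by simp
      moreover have "x \<otimes> g \<notin> R"
      proof
        assume "x \<otimes> g \<in> R"
        moreover have "x = (x \<otimes> g) \<otimes> inv g" using xG g by (simp add: m_assoc)
        ultimately show False using not by blast
      qed
      ultimately have "insert x R \<in> \<R>"
        using not RN Rg x unfolding \<R>_def by auto
      then show False using max[of "insert x R"] not by auto
    qed
  qed
  then have "card N \<le> card (R \<union> ((\<lambda>x. x \<otimes> inv g) ` R \<union> (\<lambda>x. x \<otimes> g) ` R))"
    by (rule card_mono[rotated]) (use RN N finite_subset in auto)
  also have "\<dots> \<le> card R + (card ((\<lambda>x. x \<otimes> inv g) ` R) + card ((\<lambda>x. x \<otimes> g) ` R))"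
    by (meson add_left_mono card_Un_le order_trans)
  also have "\<dots> \<le> card R + (card R + card R)"
    using finite_subset[OF RN N(1)] by (intro add_mono card_image_le order_refl)
  finally show ?thesis using that[OF RN _ Rg] by simp
qed

end

section \<open>Free actions on zero-dimensional spaces\<close>

locale free_zd_gspace = group_action G "topspace X" \<phi> for G (structure) and X :: "'x topology" and \<phi> +
  assumes continuous: "g \<in> carrier G \<Longrightarrow> continuous_map X X (\<phi> g)"
    and free: "g \<in> carrier G \<Longrightarrow> x \<in> topspace X \<Longrightarrow> \<phi> g x = x \<Longrightarrow> g = \<one>"
    and zero_dimensional: "zero_dimensional_space X"
    and Lindelof: "Lindelof_space X"
    and Hausdorff: "Hausdorff_space X"
begin

sublocale group G
  using group_hom group_hom.axioms(1) by blast

lemma act_closed [simp]: "g \<in> carrier G \<Longrightarrow> x \<in> topspace X \<Longrightarrow> \<phi> g x \<in> topspace X"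
  using element_image by blast

lemma act_mult: "g \<in> carrier G \<Longrightarrow> h \<in> carrier G \<Longrightarrow> x \<in> topspace X \<Longrightarrow> \<phi> (g \<otimes> h) x = \<phi> g (\<phi> h x)"
  using composition_rule by blast

lemma act_one [simp]: "x \<in> topspace X \<Longrightarrow> \<phi> \<one> x = x"
  using id_eq_one by (metis restrict_apply')

lemma act_inv [simp]: "g \<in> carrier G \<Longrightarrow> x \<in> topspace X \<Longrightarrow> \<phi> (inv g) (\<phi> g x) = x"
  using orbit_sym_aux by blast

lemma locally_constant_act:
  assumes "g \<in> carrier G" "locally_constant X f"
  shows "locally_constant X (\<lambda>x. f (\<phi> g x))"
  using continuous_map_compose[OF continuous[OF assms(1)] assms(2)] by (simp add: o_def)

text \<open>A continuous proper coloring with countably many colors: by freeness and the Hausdorff property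
every point has a neighborhood disjoint from its translates by the finitely many \<open>g \<in> S - {\<one>}\<close>.\<close>

lemma proper_rank:
  assumes S: "finite S" "S \<subseteq> carrier G"
  obtains rank :: "'x \<Rightarrow> nat" where "locally_constant X rank"
    "\<And>x g. x \<in> topspace X \<Longrightarrow> g \<in> S \<Longrightarrow> rank (\<phi> g x) = rank x \<Longrightarrow> g = \<one>"
proof -
  define R where "R U \<longleftrightarrow> (\<forall>g\<in>S - {\<one>}. \<forall>y\<in>U \<inter> topspace X. \<phi> g y \<notin> U)" for U
  have nbhd: "\<exists>U. openin X U \<and> x \<in> U \<and> R U" if x: "x \<in> topspace X" for x
  proof -
    have "\<exists>U. openin X U \<and> x \<in> U \<and> (\<forall>y\<in>U. \<phi> g y \<notin> U)" if g: "g \<in> S - {\<one>}" for g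
    proof -
      have gG: "g \<in> carrier G" "\<phi> g x \<noteq> x" using g S free x by auto
      then obtain V W where VW: "openin X V" "openin X W" "x \<in> V" "\<phi> g x \<in> W" "disjnt V W"
        using Hausdorff x unfolding Hausdorff_space_def by (metis act_closed)
      define U where "U = V \<inter> {y \<in> topspace X. \<phi> g y \<in> W}"
      have "openin X U"
        unfolding U_def using continuous[OF gG(1)] VW by (intro openin_Int openin_continuous_map_preimage)
      moreover have "x \<in> U" using VW x by (simp add: U_def)
      moreover have "\<forall>y\<in>U. \<phi> g y \<notin> U" using VW(5) by (auto simp: U_def disjnt_iff)
      ultimately show ?thesis by blast
    qed
    then obtain U where U: "\<And>g. g \<in> S - {\<one>} \<Longrightarrow> openin X (U g) \<and> x \<in> U g \<and> (\<forall>y\<in>U g. \<phi> g y \<notin> U g)"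
      by metis
    have "openin X ((\<Inter>g\<in>S - {\<one>}. U g) \<inter> topspace X)"
      using S U by (intro openin_INT) auto
    moreover have "x \<in> (\<Inter>g\<in>S - {\<one>}. U g) \<inter> topspace X" using U x by blast
    moreover have "R ((\<Inter>g\<in>S - {\<one>}. U g) \<inter> topspace X)" unfolding R_def using U by blast
    ultimately show ?thesis by blast
  qed
  have mono: "R V" if "R U" "V \<subseteq> U" for U V using that unfolding R_def by blast
  obtain i :: "'x \<Rightarrow> nat" and U where i: "locally_constant X i"
    "\<And>x. x \<in> topspace X \<Longrightarrow> x \<in> U (i x) \<and> R (U (i x))"
    by (rule clopen_indexing[OF zero_dimensional Lindelof nbhd mono]) blast+
  show ?thesis
  proof (rule that[OF i(1)])
    fix x g assume x: "x \<in> topspace X" "g \<in> S" "i (\<phi> g x) = i x"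
    then have "\<phi> g x \<in> topspace X" using S by auto
    with i(2)[OF x(1)] i(2)[of "\<phi> g x"] x show "g = \<one>" unfolding R_def by auto
  qed
qed

text \<open>Greedily, a point of \<open>B\<close> enters \<open>A\<close> unless a neighbor of smaller rank has done so.\<close>

lemma maximal_independent:
  assumes B: "locally_constant X (\<lambda>x. x \<in> B)" "B \<subseteq> topspace X"
    and F: "finite F" "F \<subseteq> carrier G" "\<And>g. g \<in> F \<Longrightarrow> inv g \<in> F" "\<one> \<in> F"
  obtains A where "locally_constant X (\<lambda>x. x \<in> A)" "A \<subseteq> B"
    "\<And>a g. a \<in> A \<Longrightarrow> g \<in> F \<Longrightarrow> \<phi> g a \<in> A \<Longrightarrow> g = \<one>"
    "\<And>b. b \<in> B \<Longrightarrow> \<exists>g\<in>F. \<phi> g b \<in> A"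
proof -
  obtain rank :: "'x \<Rightarrow> nat" where rank: "locally_constant X rank"
    and proper: "\<And>x g. x \<in> topspace X \<Longrightarrow> g \<in> F \<Longrightarrow> rank (\<phi> g x) = rank x \<Longrightarrow> g = \<one>"
    using proper_rank[OF F(1,2)] by metis
  define Good where "Good f x w \<longleftrightarrow>
     (w \<longleftrightarrow> x \<in> B \<and> (\<forall>g\<in>F. rank (\<phi> g x) < rank x \<longrightarrow> \<not> f (\<phi> g x)))" for f x w
  obtain L where L: "locally_constant X L" "\<And>x. x \<in> topspace X \<Longrightarrow> Good L x (L x)"
  proof (rule greedy_labelling[OF rank, of Good UNIV])
    show "locally_constant X (\<lambda>x. Good f x w)" if f: "locally_constant X f" for f w
      unfolding Good_def
      by (intro locally_constant_comp2[where h="(=)"] locally_constant_comp2[where h="(\<and>)"] B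
          locally_constant_Ball[OF F(1)] locally_constant_comp2[where h="(\<longrightarrow>)"]
          locally_constant_comp2[where h="(<)"] locally_constant_comp[where h=Not]
          locally_constant_act[of _ rank] locally_constant_act[of _ f] f rank)
        (use F(2) in auto)
    show "Good f x = Good f' x"
      if "x \<in> topspace X" "\<And>y. y \<in> topspace X \<Longrightarrow> rank y < rank x \<Longrightarrow> f y = f' y" for f f' x
      unfolding Good_def using that F(2) by (auto simp: fun_eq_iff subset_eq)
    show "\<exists>w\<in>UNIV. Good f x w" for f x
      unfolding Good_def by blast
  qed (auto simp: that)
  define A where "A = {x \<in> topspace X. L x}"
  have L': "L x \<longleftrightarrow> x \<in> B \<and> (\<forall>g\<in>F. rank (\<phi> g x) < rank x \<longrightarrow> \<not> L (\<phi> g x))" if "x \<in> topspace X" for x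
    using L(2)[OF that] unfolding Good_def .
  show ?thesis
  proof (rule that[of A])
    show "locally_constant X (\<lambda>x. x \<in> A)"
      using L(1) by (rule locally_constant_cong) (simp add: A_def)
    show "A \<subseteq> B" using L' by (auto simp: A_def)
    show "g = \<one>" if a: "a \<in> A" "g \<in> F" "\<phi> g a \<in> A" for a g
    proof (rule ccontr)
      assume "g \<noteq> \<one>"
      have g: "g \<in> carrier G" and aX: "a \<in> topspace X" "\<phi> g a \<in> topspace X"
        using a F by (auto simp: A_def)
      have "\<not> rank (\<phi> g a) < rank a"
        using L'[OF aX(1)] a by (auto simp: A_def)
      moreover have "\<not> rank a < rank (\<phi> g a)"
        using L'[OF aX(2)] a F(3)[OF a(2)] g aX by (auto simp: A_def)
      ultimately show False
        using proper[OF aX(1) a(2)] \<open>g \<noteq> \<one>\<close> by simp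
    qed
    show "\<exists>g\<in>F. \<phi> g b \<in> A" if b: "b \<in> B" for b
    proof (cases "L b")
      case True
      with b B(2) have "\<phi> \<one> b \<in> A" by (auto simp: A_def)
      then show ?thesis using F(4) by blast
    next
      case False
      with L'[of b] b B(2) obtain g where "g \<in> F" "L (\<phi> g b)" by auto
      moreover have "g \<in> carrier G" "b \<in> topspace X" using b B(2) F(2) \<open>g \<in> F\<close> by auto
      ultimately show ?thesis by (intro bexI[of _ g]) (auto simp: A_def)
    qed
  qed
qed

end

section \<open>Separating sparse points from their translates\<close>

context free_zd_gspace
begin

text \<open>The combinatorial core. The points of \<open>A\<close> lie far apart, and around each \<open>a \<in> A\<close> there is a pool
\<open>Q a\<close> of more than \<open>6 * r\<close> positions in \<open>B - A\<close> whose colors are free to be chosen. The choice has to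
make the pattern around \<open>a\<close> differ from the pattern around its translate by every \<open>g \<in> C\<close>,
using positions off \<open>A\<close> only, as the colors on \<open>A\<close> are left to later choices.

The translated pool meets the pool of at most one point of \<open>A\<close>, which may choose before or after
\<open>a\<close> in the greedy order. If it chooses later and owns more than \<open>3 * r\<close> of the translated
positions, the constraint is handed over to it; otherwise at least \<open>3 * r\<close> positions remain on which
\<open>a\<close> itself can satisfy the constraint. Either way, the point in charge fails only for a \<open>2 ^ - r\<close> fraction of its
patterns whatever the earlier choices were, and it is in charge of fewer than \<open>2 ^ r\<close>
constraints.\<close>

lemma separating_coloring_step:
  fixes r :: nat
  assumes T: "finite T" "T \<subseteq> carrier G"
    and C: "finite C" "C \<subseteq> carrier G" "\<one> \<notin> C"
    and K: "K = (\<lambda>(s, t). inv s \<otimes> t) ` (T \<times> T)"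
    and few: "card C + card (K \<times> C) < 2 ^ r"
    and B: "locally_constant X (\<lambda>x. x \<in> B)" "B \<subseteq> topspace X"
    and thick: "\<And>x. x \<in> topspace X \<Longrightarrow> 6 * r + 2 \<le> card {t \<in> T. \<phi> t x \<in> B}"
    and A: "locally_constant X (\<lambda>x. x \<in> A)" "A \<subseteq> B"
    and indep_K: "\<And>a k l. a \<in> A \<Longrightarrow> k \<in> K \<Longrightarrow> l \<in> K \<Longrightarrow> \<phi> (k \<otimes> l) a \<in> A \<Longrightarrow> k \<otimes> l = \<one>"
    and indep_T: "\<And>a s t. a \<in> A \<Longrightarrow> s \<in> T \<Longrightarrow> t \<in> T \<Longrightarrow> \<phi> (s \<otimes> inv t) a \<in> A \<Longrightarrow> s \<otimes> inv t = \<one>"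
    and c0: "locally_constant X (c0 :: 'x \<Rightarrow> bool)"
  obtains c where "locally_constant X c" "\<And>x. x \<in> topspace X - B \<Longrightarrow> c x = c0 x"
    "\<And>a g. a \<in> A \<Longrightarrow> g \<in> C \<Longrightarrow>
        \<exists>t\<in>T. \<phi> t a \<notin> A \<and> \<phi> (t \<otimes> g) a \<notin> A \<and> c (\<phi> t a) \<noteq> c (\<phi> (t \<otimes> g) a)"
proof -
  have AX: "A \<subseteq> topspace X" using A(2) B(2) by auto
  have TG [simp]: "t \<in> carrier G" if "t \<in> T" for t using that T by auto
  have CG [simp]: "g \<in> carrier G" if "g \<in> C" for g using that C by auto
  have KG [simp]: "k \<in> carrier G" if "k \<in> K" for k using that unfolding K by auto
  have K_memI: "inv s \<otimes> t \<in> K" if "s \<in> T" "t \<in> T" for s t using that unfolding K by auto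
  have K_inv: "inv k \<in> K" if "k \<in> K" for k
  proof -
    obtain s t where "s \<in> T" "t \<in> T" "k = inv s \<otimes> t" using \<open>k \<in> K\<close> unfolding K by auto
    then show ?thesis using K_memI[of t s] by (simp add: inv_mult_group)
  qed
  have finK: "finite K" using K T by auto

  have uniq_K: "k = l" if "x \<in> topspace X" "k \<in> K" "l \<in> K" "\<phi> k x \<in> A" "\<phi> l x \<in> A" for x k l
  proof -
    have "\<phi> (l \<otimes> inv k) (\<phi> k x) = \<phi> l x" using that by (simp add: act_mult)
    then have "l \<otimes> inv k = \<one>" using indep_K[of "\<phi> k x" l "inv k"] that K_inv by auto
    then show ?thesis using that by (metis KG inv_closed inv_equality inv_inv)
  qed
  have uniq_T: "s = t" if "x \<in> topspace X" "s \<in> T" "t \<in> T" "\<phi> s x \<in> A" "\<phi> t x \<in> A" for x s t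
  proof -
    have "\<phi> (t \<otimes> inv s) (\<phi> s x) = \<phi> t x" using that by (simp add: act_mult)
    then have "t \<otimes> inv s = \<one>" using indep_T[of "\<phi> s x" t s] that by auto
    then show ?thesis using that by (metis TG inv_closed inv_equality inv_inv)
  qed
  have uniq_owner: "s = t" if "y \<in> topspace X" "s \<in> T" "t \<in> T" "\<phi> (inv s) y \<in> A" "\<phi> (inv t) y \<in> A" for y s t
  proof -
    define a where "a = \<phi> (inv s) y"
    have a: "a \<in> topspace X" "a \<in> A" using that by (auto simp: a_def)
    have "\<phi> (inv t \<otimes> s) a = \<phi> (inv t) y"
      using that by (simp add: a_def act_mult[symmetric] m_assoc)
    then have "\<phi> (inv t \<otimes> s) a \<in> A" using that by simp
    moreover have "\<phi> (inv s \<otimes> s) a \<in> A" using a that by simp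
    ultimately have "inv t \<otimes> s = inv s \<otimes> s"
      by (intro uniq_K[OF a(1) K_memI[OF that(3,2)] K_memI[OF that(2,2)]])
    then show ?thesis using that by (metis TG inv_closed inv_equality inv_inv l_inv)
  qed

  \<comment> \<open>Points whose pools can interact differ by an element of \<open>H\<close>, so they never choose simultaneously.\<close>
  define H where "H = (\<lambda>(k, g). k \<otimes> g) ` (K \<times> C)"
  have "finite H" "H \<subseteq> carrier G" using finK C by (auto simp: H_def)
  then obtain rank :: "'x \<Rightarrow> nat" where rank: "locally_constant X rank"
    and proper': "\<And>x g. x \<in> topspace X \<Longrightarrow> g \<in> H \<Longrightarrow> rank (\<phi> g x) = rank x \<Longrightarrow> g = \<one>"
    using proper_rank by metis
  have proper: "k \<otimes> g = \<one>" if "x \<in> topspace X" "k \<in> K" "g \<in> C" "rank (\<phi> (k \<otimes> g) x) = rank x" for x k g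
    using proper'[of x "k \<otimes> g"] that by (auto simp: H_def)

  define Q where "Q a = {t \<in> T. \<phi> t a \<in> B \<and> \<phi> t a \<notin> A}" for a
  \<comment> \<open>Positions of the pool of \<open>a\<close> whose \<open>g\<close>-translates lie in the pool of \<open>\<phi> (k \<otimes> g) a\<close>.\<close>
  define D where "D a g k = {t \<in> T. t \<in> Q a \<and> t \<otimes> inv k \<in> Q (\<phi> (k \<otimes> g) a)}" for a g k
  define later where "later a g k \<longleftrightarrow> \<phi> (k \<otimes> g) a \<in> A \<and> rank a < rank (\<phi> (k \<otimes> g) a)" for a g k
  define deferred where "deferred a g k \<longleftrightarrow> later a g k \<and> 3 * r < card (D a g k)" for a g k
  \<comment> \<open>Positions at which the translated color is known when \<open>a\<close> chooses, or belongs to \<open>a\<close> itself.\<close>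
  define M where "M a g = {t \<in> T. t \<in> Q a \<and> \<phi> (t \<otimes> g) a \<notin> A \<and> (\<forall>k\<in>K. later a g k \<longrightarrow> t \<notin> D a g k)}" for a g
  \<comment> \<open>Color of \<open>y\<close> before \<open>a\<close> chooses; positions in \<open>B\<close> that belong to no pool get the color \<open>False\<close>.\<close>
  define old where "old f a y \<longleftrightarrow> (if y \<in> B then \<exists>s\<in>T. \<phi> (inv s) y \<in> A \<and>
      rank (\<phi> (inv s) y) < rank a \<and> s \<in> f (\<phi> (inv s) y) else c0 y)" for f :: "'x \<Rightarrow> 'a set" and a y
  \<comment> \<open>The two ways a pattern \<open>w\<close> at \<open>a\<close> can fail: a constraint of \<open>a\<close> itself, or one handed over to \<open>a\<close>.\<close>
  define bad_own where "bad_own f a g w \<longleftrightarrow> (\<forall>k\<in>K. \<not> deferred a g k) \<and>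
      (\<forall>t\<in>T. t \<in> M a g \<longrightarrow> (t \<in> w \<longleftrightarrow> (if t \<otimes> g \<in> Q a then t \<otimes> g \<in> w else old f a (\<phi> (t \<otimes> g) a))))" for f a g w
  define bad_inherited where "bad_inherited f a k g w \<longleftrightarrow>
      \<phi> (inv (k \<otimes> g)) a \<in> A \<and> deferred (\<phi> (inv (k \<otimes> g)) a) g k \<and>
      (\<forall>t\<in>T. t \<in> D (\<phi> (inv (k \<otimes> g)) a) g k \<longrightarrow> (t \<in> f (\<phi> (inv (k \<otimes> g)) a) \<longleftrightarrow> t \<otimes> inv k \<in> w))"
    for f :: "'x \<Rightarrow> 'a set" and a k g w
  define Good where "Good f a w \<longleftrightarrow> (a \<in> A \<longrightarrow> (\<forall>g\<in>C. \<not> bad_own f a g w) \<and>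
      (\<forall>k\<in>K. \<forall>g\<in>C. \<not> bad_inherited f a k g w))" for f a w

  have finQ: "finite (Q a)" "Q a \<subseteq> T" for a using T by (auto simp: Q_def)

  have exist: "\<exists>w\<in>Pow T. Good f a w" if aX: "a \<in> topspace X" for f a
  proof (cases "a \<in> A")
    case False
    then show ?thesis by (auto simp: Good_def)
  next
    case a: True
    have card_Q: "6 * r + 1 \<le> card (Q a)"
    proof -
      have one: "card {t \<in> T. \<phi> t a \<in> A} \<le> 1"
        using uniq_T[OF aX] T by (auto simp: card_le_Suc0_iff_eq)
      have "6 * r + 2 \<le> card {t \<in> T. \<phi> t a \<in> B}" using thick[OF aX] .
      also have "\<dots> \<le> card (Q a \<union> {t \<in> T. \<phi> t a \<in> A})"
        by (rule card_mono) (use T finQ in \<open>auto simp: Q_def\<close>)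
      also have "\<dots> \<le> card (Q a) + card {t \<in> T. \<phi> t a \<in> A}" by (rule card_Un_le)
      finally show ?thesis using one by linarith
    qed
    define Bad where "Bad i w = (case i of Inl g \<Rightarrow> bad_own f a g w | Inr (k, g) \<Rightarrow> bad_inherited f a k g w)" for i w
    have "\<exists>w\<subseteq>Q a. \<forall>i\<in>C <+> K \<times> C. \<not> Bad i w"
    proof (rule exists_subset_avoiding)
      show "finite (Q a)" by (rule finQ)
      show "finite (C <+> K \<times> C)" using C finK by auto
      show "card (C <+> K \<times> C) < 2 ^ r" using few C finK by (simp add: card_Plus)
      fix i assume "i \<in> C <+> K \<times> C"
      then consider (own) g where "i = Inl g" "g \<in> C"
        | (inherited) k g where "i = Inr (k, g)" "k \<in> K" "g \<in> C" by auto
      then show "\<exists>R\<subseteq>Q a. r \<le> card R \<and> inj_on (\<lambda>w. w - R) {w. w \<subseteq> Q a \<and> Bad i w}"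
      proof cases
        case own
        show ?thesis
        proof (cases "\<exists>k\<in>K. deferred a g k")
          case True
          then have none: "{w. w \<subseteq> Q a \<and> Bad i w} = {}" by (auto simp: Bad_def own bad_own_def)
          show ?thesis unfolding none using card_Q by (intro exI[of _ "Q a"]) simp
        next
          case False
          \<comment> \<open>Of the at least \<open>6 * r + 1\<close> pool positions, one may be translated into \<open>A\<close> and at most \<open>3 * r\<close> to a later pool.\<close>
          have "3 * r \<le> card (M a g)"
          proof -
            have gX: "\<phi> g a \<in> topspace X" using own aX by simp
            have one: "card {t \<in> T. \<phi> (t \<otimes> g) a \<in> A} \<le> 1"
              using uniq_T[OF gX] T own aX by (auto simp: card_le_Suc0_iff_eq act_mult)
            have few_later: "card {t \<in> Q a. \<exists>k\<in>K. later a g k \<and> t \<in> D a g k} \<le> 3 * r"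
            proof (cases "\<exists>k\<in>K. later a g k")
              case True
              then obtain k where k: "k \<in> K" "later a g k" by blast
              have "l = k" if "l \<in> K" "later a g l" for l
                using uniq_K[OF gX] that k own aX by (auto simp: later_def act_mult)
              then have "{t \<in> Q a. \<exists>k\<in>K. later a g k \<and> t \<in> D a g k} \<subseteq> D a g k" by auto
              then have "card {t \<in> Q a. \<exists>k\<in>K. later a g k \<and> t \<in> D a g k} \<le> card (D a g k)"
                by (rule card_mono[rotated]) (use T in \<open>auto simp: D_def\<close>)
              moreover have "card (D a g k) \<le> 3 * r" using False k by (auto simp: deferred_def)
              ultimately show ?thesis by linarith
            next
              case False
              then have none: "{t \<in> Q a. \<exists>k\<in>K. later a g k \<and> t \<in> D a g k} = {}" by auto
              show ?thesis unfolding none by simp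
            qed
            have "card (Q a) \<le> card (M a g \<union> ({t \<in> T. \<phi> (t \<otimes> g) a \<in> A}
                \<union> {t \<in> Q a. \<exists>k\<in>K. later a g k \<and> t \<in> D a g k}))"
              by (rule card_mono) (use T finQ in \<open>auto simp: M_def\<close>)
            also have "\<dots> \<le> card (M a g) + (card {t \<in> T. \<phi> (t \<otimes> g) a \<in> A}
                + card {t \<in> Q a. \<exists>k\<in>K. later a g k \<and> t \<in> D a g k})"
              by (meson add_left_mono card_Un_le order_trans)
            finally show ?thesis using one few_later card_Q by linarith
          qed
          moreover obtain R where R: "R \<subseteq> M a g" "card (M a g) \<le> 3 * card R"
            "\<And>t. t \<in> R \<Longrightarrow> t \<otimes> g \<notin> R"
            by (rule exists_translate_independent_subset[of "M a g" g])
              (use T own C in \<open>auto simp: M_def\<close>)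
          ultimately have "r \<le> card R" by linarith
          moreover have "inj_on (\<lambda>w. w - R) {w. w \<subseteq> Q a \<and> Bad i w}"
          proof (rule inj_onI, clarsimp)
            fix w v assume wv: "w \<subseteq> Q a" "Bad i w" "v \<subseteq> Q a" "Bad i v" "w - R = v - R"
            have "t \<in> w \<longleftrightarrow> t \<in> v" for t
            proof (cases "t \<in> R")
              case True
              then have t: "t \<in> M a g" "t \<in> T" using R(1) by (auto simp: M_def)
              have "t \<otimes> g \<in> w \<longleftrightarrow> t \<otimes> g \<in> v" using R(3)[OF True] wv(5) by blast
              then show ?thesis
                using wv(2,4) t by (simp add: Bad_def own bad_own_def)
            next
              case False
              then show ?thesis using wv(5) by blast
            qed
            then show "w = v" by blast
          qed
          moreover have "R \<subseteq> Q a" using R(1) by (auto simp: M_def)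
          ultimately show ?thesis by blast
        qed
      next
        case inherited
        define a' where "a' = \<phi> (inv (k \<otimes> g)) a"
        have aa': "\<phi> (k \<otimes> g) a' = a"
          unfolding a'_def using aX inherited by (simp add: act_mult[symmetric])
        show ?thesis
        proof (cases "deferred a' g k")
          case False
          then have none: "{w. w \<subseteq> Q a \<and> Bad i w} = {}" by (auto simp: Bad_def inherited bad_inherited_def a'_def)
          show ?thesis unfolding none using card_Q by (intro exI[of _ "Q a"]) simp
        next
          case True
          define R where "R = (\<lambda>t. t \<otimes> inv k) ` D a' g k"
          have "inj_on (\<lambda>t. t \<otimes> inv k) (D a' g k)"
            using inherited by (intro inj_onI) (auto simp: D_def)
          then have "r \<le> card R" using True by (simp add: R_def card_image deferred_def)
          moreover have "R \<subseteq> Q a" using aa' by (auto simp: R_def D_def)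
          moreover have "inj_on (\<lambda>w. w - R) {w. w \<subseteq> Q a \<and> Bad i w}"
          proof (rule inj_onI, clarsimp)
            fix w v assume wv: "Bad i w" "Bad i v" "w - R = v - R"
            have "s \<in> w \<longleftrightarrow> s \<in> v" for s
            proof (cases "s \<in> R")
              case True
              then obtain t where t: "t \<in> D a' g k" "s = t \<otimes> inv k" by (auto simp: R_def)
              then have "t \<in> T" by (simp add: D_def)
              then show ?thesis
                using wv(1,2) t by (simp add: Bad_def inherited bad_inherited_def a'_def)
            next
              case False
              then show ?thesis using wv(3) by blast
            qed
            then show "w = v" by blast
          qed
          ultimately show ?thesis by blast
        qed
      qed
    qed
    then obtain w where w: "w \<subseteq> Q a" "\<forall>i\<in>C <+> K \<times> C. \<not> Bad i w" by blast
    have "\<not> bad_own f a g w" if "g \<in> C" for g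
      using w(2)[rule_format, of "Inl g"] that by (simp add: Bad_def InlI)
    moreover have "\<not> bad_inherited f a k g w" if "k \<in> K" "g \<in> C" for k g
      using w(2)[rule_format, of "Inr (k, g)"] that by (simp add: Bad_def InrI)
    ultimately show ?thesis using w(1) finQ(2)[of a] unfolding Good_def by blast
  qed

  have lcA: "locally_constant X (\<lambda>a. \<phi> h a \<in> A)" if "h \<in> carrier G" for h
    using locally_constant_act[OF that A(1)] .
  have lcB: "locally_constant X (\<lambda>a. \<phi> h a \<in> B)" if "h \<in> carrier G" for h
    using locally_constant_act[OF that B(1)] .
  have lcrank: "locally_constant X (\<lambda>a. rank (\<phi> h a))" if "h \<in> carrier G" for h
    using locally_constant_act[OF that rank] .
  have lcQ: "locally_constant X Q"
    unfolding Q_def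
    by (intro locally_constant_Collect T(1) locally_constant_simple lcA lcB) auto
  have lcD: "locally_constant X (\<lambda>a. D a g k)" if "k \<in> K" "g \<in> C" for g k
    unfolding D_def
    by (intro locally_constant_Collect T(1) locally_constant_simple locally_constant_mem
        locally_constant_act[of _ Q] lcQ) (use that in auto)
  have lclater: "locally_constant X (\<lambda>a. later a g k)" if "k \<in> K" "g \<in> C" for g k
    unfolding later_def
    by (intro locally_constant_simple locally_constant_less lcA lcrank rank) (use that in auto)
  have lcdeferred: "locally_constant X (\<lambda>a. deferred a g k)" if "k \<in> K" "g \<in> C" for g k
    unfolding deferred_def
    by (intro locally_constant_simple lclater that locally_constant_comp[where h="\<lambda>S. 3 * r < card S"] lcD)
  have lcM: "locally_constant X (\<lambda>a. M a g)" if "g \<in> C" for g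
    unfolding M_def
    by (intro locally_constant_Collect T(1) locally_constant_simple locally_constant_mem lcQ lcA
        locally_constant_Ball[OF finK] lclater lcD) (use that in auto)
  have lcGood: "locally_constant X (\<lambda>a. Good f a w)" if f: "locally_constant X f" for f w
  proof -
    have lcold: "locally_constant X (\<lambda>a. old f a (\<phi> h a))" if h: "h \<in> carrier G" for h
      unfolding old_def
      by (intro locally_constant_if lcB locally_constant_Bex T(1) locally_constant_simple
          locally_constant_less rank locally_constant_mem
          locally_constant_act[of h "\<lambda>y. \<phi> (inv s) y \<in> A" for s]
          locally_constant_act[of h "\<lambda>y. rank (\<phi> (inv s) y)" for s]
          locally_constant_act[of h "\<lambda>y. f (\<phi> (inv s) y)" for s]
          locally_constant_act[of _ f] f lcA lcrank locally_constant_act[of h c0] c0 h) auto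
    have "locally_constant X (\<lambda>a. bad_own f a g w)" if "g \<in> C" for g
      unfolding bad_own_def
      by (intro locally_constant_simple locally_constant_Ball[OF finK] locally_constant_Ball[OF T(1)]
          lcdeferred locally_constant_mem lcM locally_constant_if lcQ lcold locally_constant_const)
        (use that in auto)
    moreover have "locally_constant X (\<lambda>a. bad_inherited f a k g w)" if kg: "k \<in> K" "g \<in> C" for k g
    proof -
      have kgG: "inv (k \<otimes> g) \<in> carrier G" using kg by simp
      show ?thesis
        unfolding bad_inherited_def
        by (intro locally_constant_simple lcA[OF kgG] locally_constant_Ball[OF T(1)]
            locally_constant_act[OF kgG, of "\<lambda>a. deferred a g k"] lcdeferred kg
            locally_constant_mem locally_constant_act[OF kgG, of "\<lambda>a. D a g k"] lcD
            locally_constant_act[OF kgG f] locally_constant_const)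
    qed
    ultimately show ?thesis
      unfolding Good_def
      by (intro locally_constant_simple A locally_constant_Ball finK C(1))
  qed

  have local: "Good f a = Good f' a"
    if aX: "a \<in> topspace X" and eq: "\<And>y. y \<in> topspace X \<Longrightarrow> rank y < rank a \<Longrightarrow> f y = f' y" for f f' a
  proof -
    have "old f a y = old f' a y" if "y \<in> topspace X" for y
    proof -
      have "f (\<phi> (inv s) y) = f' (\<phi> (inv s) y)" if "s \<in> T" "rank (\<phi> (inv s) y) < rank a" for s
        using that \<open>y \<in> topspace X\<close> by (intro eq) auto
      then show ?thesis unfolding old_def by (metis (no_types, lifting))
    qed
    then have "bad_own f a g = bad_own f' a g" if "g \<in> C" for g
      unfolding bad_own_def fun_eq_iff using aX that by simp
    moreover have "bad_inherited f a k g = bad_inherited f' a k g" if kg: "k \<in> K" "g \<in> C" for k g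
    proof (cases "deferred (\<phi> (inv (k \<otimes> g)) a) g k")
      case True
      have "\<phi> (k \<otimes> g) (\<phi> (inv (k \<otimes> g)) a) = a" using aX kg by (simp add: act_mult[symmetric])
      then have "rank (\<phi> (inv (k \<otimes> g)) a) < rank a" using True by (simp add: deferred_def later_def)
      then have "f (\<phi> (inv (k \<otimes> g)) a) = f' (\<phi> (inv (k \<otimes> g)) a)" using aX kg by (intro eq) auto
      then show ?thesis unfolding bad_inherited_def fun_eq_iff by simp
    next
      case False
      then show ?thesis unfolding bad_inherited_def fun_eq_iff by simp
    qed
    ultimately show ?thesis unfolding Good_def fun_eq_iff by simp
  qed

  obtain S where S: "locally_constant X S" "\<And>a. a \<in> topspace X \<Longrightarrow> Good S a (S a)"
  proof (rule greedy_labelling[OF rank, of Good "Pow T"])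
    show "countable (Pow T)" using T(1) by (simp add: countable_finite)
    show "Good f a = Good f' a"
      if "a \<in> topspace X" "\<And>y. y \<in> topspace X \<Longrightarrow> rank y < rank a \<Longrightarrow> f y = f' y" for f f' a
      using that by (rule local)
  qed (use lcGood exist in blast)+

  define c where "c y \<longleftrightarrow> (if y \<in> B then \<exists>s\<in>T. \<phi> (inv s) y \<in> A \<and> s \<in> S (\<phi> (inv s) y) else c0 y)" for y
  have c_pool: "c (\<phi> t a) \<longleftrightarrow> t \<in> S a" if "a \<in> A" "t \<in> Q a" for a t
  proof -
    have t: "t \<in> T" "\<phi> t a \<in> B" and aX: "a \<in> topspace X" using that AX by (auto simp: Q_def)
    have "s = t" if "s \<in> T" "\<phi> (inv s) (\<phi> t a) \<in> A" for s
      by (rule uniq_owner[of "\<phi> t a"]) (use that t aX \<open>a \<in> A\<close> in auto)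
    moreover have "\<phi> (inv t) (\<phi> t a) = a" using t(1) aX by simp
    ultimately show ?thesis unfolding c_def using t \<open>a \<in> A\<close> by (metis (no_types, lifting))
  qed
  show ?thesis
  proof (rule that[of c])
    show "locally_constant X c"
      unfolding c_def
      by (intro locally_constant_if B locally_constant_Bex T(1) locally_constant_simple lcA
          locally_constant_mem locally_constant_act[of _ S] S c0) auto
    show "c x = c0 x" if "x \<in> topspace X - B" for x using that by (simp add: c_def)
    fix a g assume a: "a \<in> A" and g: "g \<in> C"
    have aX: "a \<in> topspace X" using a AX by auto
    show "\<exists>t\<in>T. \<phi> t a \<notin> A \<and> \<phi> (t \<otimes> g) a \<notin> A \<and> c (\<phi> t a) \<noteq> c (\<phi> (t \<otimes> g) a)"
    proof (cases "\<exists>k\<in>K. deferred a g k")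
      case True
      then obtain k where k: "k \<in> K" "deferred a g k" by blast
      \<comment> \<open>The constraint was handed over to \<open>b\<close>.\<close>
      define b where "b = \<phi> (k \<otimes> g) a"
      have b: "b \<in> A" "b \<in> topspace X" using k AX by (auto simp: b_def deferred_def later_def)
      have b_inv: "\<phi> (inv (k \<otimes> g)) b = a" unfolding b_def using aX k g by simp
      have "\<not> bad_inherited S b k g (S b)" using S(2)[OF b(2)] b k g by (simp add: Good_def)
      then obtain t where t: "t \<in> T" "t \<in> D a g k" "\<not> (t \<in> S a \<longleftrightarrow> t \<otimes> inv k \<in> S b)"
        using a k unfolding bad_inherited_def b_inv by blast
      have tQ: "t \<in> Q a" "t \<otimes> inv k \<in> Q b" using t by (auto simp: D_def b_def)
      have "\<phi> (t \<otimes> inv k) b = \<phi> ((t \<otimes> inv k) \<otimes> (k \<otimes> g)) a"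
        unfolding b_def using t k g aX by (simp add: act_mult)
      also have "(t \<otimes> inv k) \<otimes> (k \<otimes> g) = t \<otimes> g"
        using t k g by (simp add: m_assoc inv_solve_left')
      finally have tb: "\<phi> (t \<otimes> inv k) b = \<phi> (t \<otimes> g) a" .
      show ?thesis
        using c_pool[OF a tQ(1)] c_pool[OF b(1) tQ(2)] t(1,3) tQ unfolding tb
        by (intro bexI[of _ t]) (auto simp: Q_def tb)
    next
      case False
      have "\<not> bad_own S a g (S a)" using S(2)[OF aX] a g by (simp add: Good_def)
      then obtain t where t: "t \<in> T" "t \<in> M a g"
        "\<not> (t \<in> S a \<longleftrightarrow> (if t \<otimes> g \<in> Q a then t \<otimes> g \<in> S a else old S a (\<phi> (t \<otimes> g) a)))"
        using False unfolding bad_own_def by blast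
      define y where "y = \<phi> (t \<otimes> g) a"
      have yX: "y \<in> topspace X" using aX t g by (simp add: y_def)
      have tQ: "t \<in> Q a" and yA: "y \<notin> A" using t by (auto simp: M_def y_def)
      have "c y \<longleftrightarrow> (if t \<otimes> g \<in> Q a then t \<otimes> g \<in> S a else old S a y)"
      proof (cases "t \<otimes> g \<in> Q a")
        case True
        then show ?thesis using c_pool[OF a True] by (simp add: y_def)
      next
        case notQ: False
        \<comment> \<open>The owner of \<open>y\<close>, if any, is not later since \<open>t \<in> M a g\<close>, and not \<open>a\<close> since \<open>t \<otimes> g \<notin> Q a\<close>.\<close>
        have "rank (\<phi> (inv s) y) < rank a" if s: "s \<in> T" "\<phi> (inv s) y \<in> A" and yB: "y \<in> B" for s
        proof (rule ccontr)
          assume neg: "\<not> ?thesis"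
          define k where "k = inv s \<otimes> t"
          have k: "k \<in> K" using K_memI s t by (simp add: k_def)
          have ka: "\<phi> (inv s) y = \<phi> (k \<otimes> g) a"
            using s t g aX by (simp add: y_def k_def act_mult)
          have tk: "t \<otimes> inv k = s"
            using s t by (simp add: k_def inv_mult_group m_assoc[symmetric])
          have "\<phi> s (\<phi> (inv s) y) = y"
            using s yX act_inv[of "inv s" y] by simp
          then have "s \<in> Q (\<phi> (k \<otimes> g) a)" using s yA yB ka by (simp add: Q_def)
          then have "t \<in> D a g k" using t(1) tQ tk by (simp add: D_def)
          then have "\<not> later a g k" using t(2) k by (auto simp: M_def)
          then have "rank (\<phi> (k \<otimes> g) a) = rank a" using neg s ka by (auto simp: later_def)
          then have "k \<otimes> g = \<one>" using proper aX k g by blast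
          then have "t \<otimes> g = s"
          proof -
            have "t \<otimes> g = s \<otimes> (k \<otimes> g)"
              using s t g by (simp add: k_def m_assoc[symmetric])
            then show ?thesis using \<open>k \<otimes> g = \<one>\<close> s by simp
          qed
          then have "t \<otimes> g \<in> Q a" using s yA yB by (simp add: Q_def y_def)
          with notQ show False by simp
        qed
        then have "c y \<longleftrightarrow> old S a y" unfolding c_def old_def by auto
        with notQ show ?thesis by simp
      qed
      then show ?thesis
        using c_pool[OF a tQ] t tQ yA by (intro bexI[of _ t]) (auto simp: y_def Q_def)
    qed
  qed
qed

end

section \<open>Separation within windows independent of the space\<close>

text \<open>One stage of the construction, with bounds \<open>E'\<close> and \<open>D\<close> that serve all spaces at once. The set \<open>B\<close>
holds the points whose color is still open and \<open>E\<close> bounds the distance to it. The stage fixes the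
colors on \<open>B - A\<close> so that every point \<open>x\<close> is told apart from \<open>\<phi> \<gamma> x\<close> within the window \<open>D\<close>, no
matter how \<open>A\<close> is colored later.\<close>

definition separation_stage ::
    "'x itself \<Rightarrow> ('g, 'm) monoid_scheme \<Rightarrow> 'g \<Rightarrow> 'g set \<Rightarrow> 'g set \<Rightarrow> 'g set \<Rightarrow> bool" where
  "separation_stage _ G \<gamma> E E' D \<longleftrightarrow>
    (\<forall>(X :: 'x topology) \<phi> B c0. free_zd_gspace G X \<phi> \<longrightarrow>
       locally_constant X (\<lambda>x. x \<in> B) \<longrightarrow> B \<subseteq> topspace X \<longrightarrow>
       (\<forall>x\<in>topspace X. \<exists>d\<in>E. \<phi> d x \<in> B) \<longrightarrow> locally_constant X (c0 :: 'x \<Rightarrow> bool) \<longrightarrow>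
       (\<exists>A c. locally_constant X (\<lambda>x. x \<in> A) \<and> A \<subseteq> B \<and>
          (\<forall>x\<in>topspace X. \<exists>d\<in>E'. \<phi> d x \<in> A) \<and>
          locally_constant X c \<and> (\<forall>x\<in>topspace X - B. c x = c0 x) \<and>
          (\<forall>c'. (\<forall>x\<in>topspace X - A. c' x = c x) \<longrightarrow>
             (\<forall>x\<in>topspace X. \<exists>d\<in>D. c' (\<phi> (d \<otimes>\<^bsub>G\<^esub> \<gamma>) x) \<noteq> c' (\<phi> d x)))))"

lemma separation_stageE:
  fixes X :: "'x topology" and c0 :: "'x \<Rightarrow> bool"
  assumes "separation_stage TYPE('x) G \<gamma> E E' D" "free_zd_gspace G X \<phi>"
    and "locally_constant X (\<lambda>x. x \<in> B)" "B \<subseteq> topspace X"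
    and "\<forall>x\<in>topspace X. \<exists>d\<in>E. \<phi> d x \<in> B" "locally_constant X c0"
  obtains A c where "locally_constant X (\<lambda>x. x \<in> A)" "A \<subseteq> B"
    "\<forall>x\<in>topspace X. \<exists>d\<in>E'. \<phi> d x \<in> A"
    "locally_constant X c" "\<forall>x\<in>topspace X - B. c x = c0 x"
    "\<And>c'. \<forall>x\<in>topspace X - A. c' x = c x \<Longrightarrow>
       \<forall>x\<in>topspace X. \<exists>d\<in>D. c' (\<phi> (d \<otimes>\<^bsub>G\<^esub> \<gamma>) x) \<noteq> c' (\<phi> d x)"
  using assms(1)[unfolded separation_stage_def, THEN spec, THEN spec, THEN spec, THEN spec,
      THEN mp, OF assms(2), THEN mp, OF assms(3), THEN mp, OF assms(4),
      THEN mp, OF assms(5), THEN mp, OF assms(6)]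
  by (elim exE conjE) (rule that, assumption+, elim allE impE)

context group
begin

text \<open>If \<open>\<phi> d x \<in> A\<close>, then telling \<open>x\<close> apart from \<open>\<phi> \<gamma> x\<close> means telling \<open>\<phi> d x\<close> apart from its
translate by the conjugate \<open>d \<otimes> \<gamma> \<otimes> inv d\<close>; as \<open>A\<close> is met within \<open>E'\<close>, finitely many conjugates
suffice. All finite sets are built from \<open>E\<close>, \<open>\<gamma>\<close> and a number \<open>r\<close> before a space is given: \<open>T\<close> has size
linear in \<open>r\<close> and the number of constraints is polynomial in the size of \<open>T\<close>, so for a large \<open>r\<close>
there are fewer than \<open>2 ^ r\<close> of them.\<close>

lemma uniform_separation_stage:
  assumes inf: "infinite (carrier G)"
    and E: "finite E" "E \<subseteq> carrier G" "E \<noteq> {}"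
    and gam: "\<gamma> \<in> carrier G" "\<gamma> \<noteq> \<one>"
  shows "\<exists>E' D. finite E' \<and> E' \<subseteq> carrier G \<and> E' \<noteq> {} \<and> finite D \<and> D \<subseteq> carrier G \<and>
    separation_stage TYPE('x) G \<gamma> E E' D"
proof -
  obtain r where r: "4 * card E * ((6 * r + 2) * card E) ^ 6 < 2 ^ r"
    using exponential_beats_power by blast
  obtain T where T: "finite T" "T \<subseteq> carrier G" "card T \<le> (6 * r + 2) * card E"
    and thick: "\<And>Y. \<forall>x\<in>carrier G. \<exists>d\<in>E. d \<otimes> x \<in> Y \<Longrightarrow> 6 * r + 2 \<le> card {t \<in> T. t \<in> Y}"
    using exists_thick_set[OF inf E(1,2), of "6 * r + 2"] by blast
  have "6 * r + 2 \<le> card {t \<in> T. t \<in> carrier G}"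
    by (rule thick) (use E in auto)
  then have T_ne: "T \<noteq> {}" by auto
  define K where "K = (\<lambda>(s, t). inv s \<otimes> t) ` (T \<times> T)"
  \<comment> \<open>Independence for the products of two elements of \<open>K\<close> keeps the pools of distinct points of \<open>A\<close> apart; the other elements of \<open>F\<close> ensure that no translate of \<open>T\<close> contains two points of \<open>A\<close>.\<close>
  define F where "F = (\<lambda>(k, l). k \<otimes> l) ` (K \<times> K) \<union> (\<lambda>(s, t). s \<otimes> inv t) ` (T \<times> T)"
  define E' where "E' = (\<lambda>(f, d). f \<otimes> d) ` (F \<times> E)"
  define C where "C = (\<lambda>d. d \<otimes> \<gamma> \<otimes> inv d) ` E'"
  define D where "D = (\<lambda>(t, d). t \<otimes> d) ` (T \<times> E')"
  have fin: "finite K" "finite F" "finite E'" "finite C" "finite D"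
    using T(1) E(1) by (auto simp: K_def F_def E'_def C_def D_def)
  have TG: "t \<in> carrier G" if "t \<in> T" for t using that T by auto
  have KG: "k \<in> carrier G" if "k \<in> K" for k using that TG by (auto simp: K_def)
  have FG: "f \<in> carrier G" if "f \<in> F" for f using that TG KG by (auto simp: F_def)
  have E'G: "d \<in> carrier G" if "d \<in> E'" for d using that FG E(2) by (auto simp: E'_def)
  have CG: "g \<in> carrier G" if "g \<in> C" for g using that E'G gam by (auto simp: C_def)
  have C1: "\<one> \<notin> C"
  proof
    assume "\<one> \<in> C"
    then obtain d where d: "d \<in> E'" "d \<otimes> \<gamma> \<otimes> inv d = \<one>" by (auto simp: C_def)
    then have "d \<otimes> \<gamma> = d" using E'G gam by (metis inv_closed inv_equality inv_inv m_closed)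
    then show False using E'G[OF d(1)] gam by simp
  qed
  have F_one: "\<one> \<in> F"
  proof -
    obtain t where "t \<in> T" using T_ne by blast
    then have "t \<otimes> inv t \<in> F" unfolding F_def by (intro UnI2 image_eqI[of _ _ "(t, t)"]) auto
    then show ?thesis using TG[OF \<open>t \<in> T\<close>] by simp
  qed
  have K_inv: "inv k \<in> K" if "k \<in> K" for k
  proof -
    obtain s t where st: "s \<in> T" "t \<in> T" "k = inv s \<otimes> t" using \<open>k \<in> K\<close> by (auto simp: K_def)
    then have "inv k = inv t \<otimes> s" using TG by (simp add: inv_mult_group)
    then show ?thesis using st by (auto simp: K_def)
  qed
  have F_inv: "inv f \<in> F" if "f \<in> F" for f
  proof -
    from \<open>f \<in> F\<close> consider (K) k l where "k \<in> K" "l \<in> K" "f = k \<otimes> l"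
      | (T) s t where "s \<in> T" "t \<in> T" "f = s \<otimes> inv t" by (auto simp: F_def)
    then show ?thesis
    proof cases
      case K
      then have "inv f = inv l \<otimes> inv k" using KG by (simp add: inv_mult_group)
      then show ?thesis using K K_inv by (auto simp: F_def)
    next
      case T
      then have "inv f = t \<otimes> inv s" using TG by (simp add: inv_mult_group)
      then show ?thesis using T by (auto simp: F_def)
    qed
  qed
  have few: "card C + card (K \<times> C) < 2 ^ r"
  proof -
    define t where "t = card T"
    have t1: "1 \<le> t" using T(1) T_ne by (simp add: t_def Suc_leI card_gt_0_iff)
    have cK: "card K \<le> t ^ 2"
      using card_image_le[of "T \<times> T" "\<lambda>(s, t). inv s \<otimes> t"] T(1)
      by (simp add: K_def t_def power2_eq_square card_cartesian_product)
    have "card F \<le> card K * card K + t * t"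
      unfolding F_def
    proof (rule order_trans[OF card_Un_le add_mono])
      show "card ((\<lambda>(k, l). k \<otimes> l) ` (K \<times> K)) \<le> card K * card K"
        using card_image_le[of "K \<times> K" "\<lambda>(k, l). k \<otimes> l"] fin(1)
        by (simp add: card_cartesian_product)
      show "card ((\<lambda>(s, t). s \<otimes> inv t) ` (T \<times> T)) \<le> t * t"
        using card_image_le[of "T \<times> T" "\<lambda>(s, t). s \<otimes> inv t"] T(1)
        by (simp add: t_def card_cartesian_product)
    qed
    also have "\<dots> \<le> t ^ 2 * t ^ 2 + t ^ 4"
      using cK power_increasing[OF _ t1, of 2 4]
      by (intro add_mono mult_mono) (simp_all add: power2_eq_square)
    also have "\<dots> = 2 * t ^ 4" by (simp add: power_numeral_reduce mult_ac)
    finally have cF: "card F \<le> 2 * t ^ 4" .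
    have "card C \<le> card E'" unfolding C_def using fin(3) by (rule card_image_le)
    also have "\<dots> \<le> card F * card E"
      using card_image_le[of "F \<times> E" "\<lambda>(f, d). f \<otimes> d"] fin(2) E(1)
      by (simp add: E'_def card_cartesian_product)
    also have "\<dots> \<le> 2 * t ^ 4 * card E" using cF by simp
    finally have cC: "card C \<le> 2 * t ^ 4 * card E" .
    have "card C + card (K \<times> C) = card C * (1 + card K)"
      by (simp add: card_cartesian_product)
    also have "\<dots> \<le> (2 * t ^ 4 * card E) * (t ^ 2 + t ^ 2)"
      using cC cK t1 by (intro mult_mono add_mono) auto
    also have "\<dots> = 4 * card E * t ^ 6" by (simp add: power_numeral_reduce mult_ac)
    also have "\<dots> \<le> 4 * card E * ((6 * r + 2) * card E) ^ 6"
      using T(3) by (intro mult_left_mono power_mono) (auto simp: t_def)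
    also have "\<dots> < 2 ^ r" by (rule r)
    finally show ?thesis .
  qed
  show ?thesis
  proof (rule exI[of _ E'], rule exI[of _ D], unfold separation_stage_def, intro conjI allI impI)
    show "finite E'" "finite D" by (rule fin)+
    show "E' \<subseteq> carrier G" "D \<subseteq> carrier G" using E'G TG by (auto simp: D_def)
    show "E' \<noteq> {}" using F_one E(3) by (auto simp: E'_def)
    fix X :: "'x topology" and \<phi> B and c0 :: "'x \<Rightarrow> bool"
    assume X: "free_zd_gspace G X \<phi>" and B: "locally_constant X (\<lambda>x. x \<in> B)" "B \<subseteq> topspace X"
      and synd: "\<forall>x\<in>topspace X. \<exists>d\<in>E. \<phi> d x \<in> B" and c0: "locally_constant X c0"
    interpret X: free_zd_gspace G X \<phi> by (rule X)
    have F_sub: "F \<subseteq> carrier G" using FG by auto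
    obtain A where A: "locally_constant X (\<lambda>x. x \<in> A)" "A \<subseteq> B"
      and indep: "\<And>a f. a \<in> A \<Longrightarrow> f \<in> F \<Longrightarrow> \<phi> f a \<in> A \<Longrightarrow> f = \<one>"
      and max: "\<And>b. b \<in> B \<Longrightarrow> \<exists>f\<in>F. \<phi> f b \<in> A"
      by (rule X.maximal_independent[OF B fin(2) F_sub F_inv F_one]) blast+
    have A_synd: "\<exists>d\<in>E'. \<phi> d x \<in> A" if x: "x \<in> topspace X" for x
    proof -
      obtain d where d: "d \<in> E" "\<phi> d x \<in> B" using synd x by blast
      then obtain f where f: "f \<in> F" "\<phi> f (\<phi> d x) \<in> A" using max by blast
      then have "\<phi> (f \<otimes> d) x \<in> A" using d E(2) FG x by (subst X.act_mult) auto
      then show ?thesis using d f by (auto simp: E'_def)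
    qed
    have thickX: "6 * r + 2 \<le> card {t \<in> T. \<phi> t x \<in> B}" if x: "x \<in> topspace X" for x
    proof -
      have "\<exists>d\<in>E. d \<otimes> h \<in> {h \<in> carrier G. \<phi> h x \<in> B}" if h: "h \<in> carrier G" for h
      proof -
        obtain d where "d \<in> E" "\<phi> d (\<phi> h x) \<in> B" using synd x h X.act_closed by blast
        then show ?thesis using E(2) h x by (auto simp: X.act_mult intro!: bexI[of _ d])
      qed
      then have "6 * r + 2 \<le> card {t \<in> T. t \<in> {h \<in> carrier G. \<phi> h x \<in> B}}"
        by (intro thick) blast
      also have "{t \<in> T. t \<in> {h \<in> carrier G. \<phi> h x \<in> B}} = {t \<in> T. \<phi> t x \<in> B}" using TG by auto
      finally show ?thesis .
    qed
    have C_sub: "C \<subseteq> carrier G" using CG by auto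
    have iK: "k \<otimes> l = \<one>" if "a \<in> A" "k \<in> K" "l \<in> K" "\<phi> (k \<otimes> l) a \<in> A" for a k l
      using that by (intro indep[of a]) (auto simp: F_def)
    have iT: "s \<otimes> inv t = \<one>" if "a \<in> A" "s \<in> T" "t \<in> T" "\<phi> (s \<otimes> inv t) a \<in> A" for a s t
      using that by (intro indep[of a]) (auto simp: F_def)
    obtain c where c: "locally_constant X c" "\<And>x. x \<in> topspace X - B \<Longrightarrow> c x = c0 x"
      and sep: "\<And>a g. a \<in> A \<Longrightarrow> g \<in> C \<Longrightarrow>
        \<exists>t\<in>T. \<phi> t a \<notin> A \<and> \<phi> (t \<otimes> g) a \<notin> A \<and> c (\<phi> t a) \<noteq> c (\<phi> (t \<otimes> g) a)"
      by (rule X.separating_coloring_step[OF T(1,2) fin(4) C_sub C1 K_def few B thickX A iK iT c0]) blast+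
    have final: "\<exists>d\<in>D. c' (\<phi> (d \<otimes> \<gamma>) x) \<noteq> c' (\<phi> d x)"
      if c': "\<forall>x\<in>topspace X - A. c' x = c x" and x: "x \<in> topspace X" for c' x
    proof -
      obtain d where d: "d \<in> E'" "\<phi> d x \<in> A" using A_synd[OF x] by blast
      define g where "g = d \<otimes> \<gamma> \<otimes> inv d"
      have dG: "d \<in> carrier G" and gC: "g \<in> C" using d E'G by (auto simp: g_def C_def)
      obtain t where t: "t \<in> T" "\<phi> t (\<phi> d x) \<notin> A" "\<phi> (t \<otimes> g) (\<phi> d x) \<notin> A"
        "c (\<phi> t (\<phi> d x)) \<noteq> c (\<phi> (t \<otimes> g) (\<phi> d x))"
        using sep[OF d(2) gC] by blast
      have tG: "t \<in> carrier G" "g \<in> carrier G" using t TG CG gC by auto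
      have 1: "\<phi> t (\<phi> d x) = \<phi> (t \<otimes> d) x" using tG dG x by (simp add: X.act_mult)
      have "g \<otimes> d = d \<otimes> \<gamma>" using dG gam by (simp add: g_def m_assoc)
      then have "(t \<otimes> g) \<otimes> d = t \<otimes> d \<otimes> \<gamma>" using tG dG gam by (simp add: m_assoc)
      then have 2: "\<phi> (t \<otimes> g) (\<phi> d x) = \<phi> (t \<otimes> d \<otimes> \<gamma>) x"
        using tG dG x by (simp flip: X.act_mult)
      have "\<phi> (t \<otimes> d) x \<in> topspace X" "\<phi> (t \<otimes> d \<otimes> \<gamma>) x \<in> topspace X"
        using tG dG x gam by auto
      then have "c' (\<phi> (t \<otimes> d \<otimes> \<gamma>) x) \<noteq> c' (\<phi> (t \<otimes> d) x)"
        using t c' unfolding 1 2 by auto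
      moreover have "t \<otimes> d \<in> D" using t d by (auto simp: D_def)
      ultimately show ?thesis by blast
    qed
    show "\<exists>A c. locally_constant X (\<lambda>x. x \<in> A) \<and> A \<subseteq> B \<and>
          (\<forall>x\<in>topspace X. \<exists>d\<in>E'. \<phi> d x \<in> A) \<and>
          locally_constant X c \<and> (\<forall>x\<in>topspace X - B. c x = c0 x) \<and>
          (\<forall>c'. (\<forall>x\<in>topspace X - A. c' x = c x) \<longrightarrow>
             (\<forall>x\<in>topspace X. \<exists>d\<in>D. c' (\<phi> (d \<otimes> \<gamma>) x) \<noteq> c' (\<phi> d x)))"
    proof (intro exI[of _ A] exI[of _ c] conjI ballI allI impI)
      show "\<exists>d\<in>D. c' (\<phi> (d \<otimes> \<gamma>) x) \<noteq> c' (\<phi> d x)"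
        if "\<forall>x\<in>topspace X - A. c' x = c x" "x \<in> topspace X" for c' x
        using that by (rule final)
    qed (fact A A_synd c | assumption | erule A_synd c(2))+
  qed
qed

text \<open>The order of quantifiers matters: the windows \<open>D n\<close> depend neither on the space nor on the number
\<open>N\<close> of requirements, so they define a single compact set of separated points in the shift. In
general no coloring meets all requirements at once: for the integers acting on the 2-adic integers
every continuous coloring is periodic.\<close>

lemma uniform_separating_colorings:
  assumes inf: "infinite (carrier G)"
    and gam: "\<And>n. \<gamma> n \<in> carrier G" "\<And>n. \<gamma> n \<noteq> \<one>"
  obtains D :: "nat \<Rightarrow> 'a set" where "\<And>n. finite (D n)" "\<And>n. D n \<subseteq> carrier G"
    "\<And>(X :: 'x topology) \<phi> N. free_zd_gspace G X \<phi> \<Longrightarrow>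
       \<exists>c :: 'x \<Rightarrow> bool. locally_constant X c \<and>
         (\<forall>n<N. \<forall>x\<in>topspace X. \<exists>d\<in>D n. c (\<phi> (d \<otimes> \<gamma> n) x) \<noteq> c (\<phi> d x))"
proof -
  define stage where "stage n E E' D \<longleftrightarrow>
    finite D \<and> D \<subseteq> carrier G \<and> separation_stage TYPE('x) G (\<gamma> n) E E' D" for n E E' D
  define P where "P n E \<longleftrightarrow> finite E \<and> E \<subseteq> carrier G \<and> E \<noteq> {} \<and> (n = 0 \<longrightarrow> E = {\<one>})" for n :: nat and E
  have "\<exists>Es. \<forall>n. P n (Es n) \<and> (\<exists>D. stage n (Es n) (Es (Suc n)) D)"
  proof (rule dependent_nat_choice[of P "\<lambda>n E E'. \<exists>D. stage n E E' D"])
    show "\<exists>E. P 0 E" by (rule exI[of _ "{\<one>}"]) (simp add: P_def)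
    show "\<exists>E'. P (Suc n) E' \<and> (\<exists>D. stage n E E' D)" if "P n E" for E n
    proof -
      have "finite E" "E \<subseteq> carrier G" "E \<noteq> {}" using that by (simp_all add: P_def)
      then obtain E' D where "finite E'" "E' \<subseteq> carrier G" "E' \<noteq> {}" "finite D" "D \<subseteq> carrier G"
        "separation_stage TYPE('x) G (\<gamma> n) E E' D"
        using uniform_separation_stage[OF inf _ _ _ gam(1,2)[of n], of E, where ?'x = 'x] by metis
      then show ?thesis unfolding P_def stage_def by (intro exI[of _ E']) auto
    qed
  qed
  then obtain Es D where Es: "\<And>n. P n (Es n)" and D: "\<And>n. stage n (Es n) (Es (Suc n)) (D n)"
    by metis
  show ?thesis
  proof (rule that[of D])
    show "finite (D n)" "D n \<subseteq> carrier G" for n using D[of n] by (simp_all add: stage_def)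
    fix X :: "'x topology" and \<phi> N assume X: "free_zd_gspace G X \<phi>"
    interpret X: free_zd_gspace G X \<phi> by (rule X)
    \<comment> \<open>\<open>B\<close> is the set of points whose color is still open after the first \<open>N\<close> stages.\<close>
    define good where "good N B c \<longleftrightarrow> locally_constant X (\<lambda>x. x \<in> B) \<and> B \<subseteq> topspace X \<and>
        (\<forall>x\<in>topspace X. \<exists>d\<in>Es N. \<phi> d x \<in> B) \<and> locally_constant X c \<and>
        (\<forall>c'. (\<forall>x\<in>topspace X - B. c' x = c x) \<longrightarrow>
           (\<forall>n<N. \<forall>x\<in>topspace X. \<exists>d\<in>D n. c' (\<phi> (d \<otimes> \<gamma> n) x) \<noteq> c' (\<phi> d x)))"
      for N B and c :: "'x \<Rightarrow> bool"
    have "\<exists>B c. good N B c"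
    proof (induction N)
      case 0
      have "locally_constant X (\<lambda>x. x \<in> topspace X)"
        by (rule locally_constant_cong[of _ "\<lambda>x. True"]) auto
      then show ?case
        using Es[of 0] by (intro exI[of _ "topspace X"] exI[of _ "\<lambda>x. True"]) (simp add: P_def good_def)
    next
      case (Suc N)
      then obtain B c0 where good: "good N B c0" by blast
      then have B: "locally_constant X (\<lambda>x. x \<in> B)" "B \<subseteq> topspace X"
          "\<forall>x\<in>topspace X. \<exists>d\<in>Es N. \<phi> d x \<in> B" "locally_constant X c0"
        by (simp_all add: good_def)
      have old: "\<forall>n<N. \<forall>x\<in>topspace X. \<exists>d\<in>D n. c' (\<phi> (d \<otimes> \<gamma> n) x) \<noteq> c' (\<phi> d x)"
        if "\<forall>x\<in>topspace X - B. c' x = c0 x" for c'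
        using good[unfolded good_def] that by simp
      have "separation_stage TYPE('x) G (\<gamma> N) (Es N) (Es (Suc N)) (D N)"
        using D[of N] by (simp add: stage_def)
      then obtain A c where A: "locally_constant X (\<lambda>x. x \<in> A)" "A \<subseteq> B"
          "\<forall>x\<in>topspace X. \<exists>d\<in>Es (Suc N). \<phi> d x \<in> A"
          "locally_constant X c" "\<forall>x\<in>topspace X - B. c x = c0 x"
        and new: "\<And>c'. \<forall>x\<in>topspace X - A. c' x = c x \<Longrightarrow>
             \<forall>x\<in>topspace X. \<exists>d\<in>D N. c' (\<phi> (d \<otimes> \<gamma> N) x) \<noteq> c' (\<phi> d x)"
        by (rule separation_stageE[OF _ X B]) (rule that; assumption)
      have "\<forall>n<Suc N. \<forall>x\<in>topspace X. \<exists>d\<in>D n. c' (\<phi> (d \<otimes> \<gamma> n) x) \<noteq> c' (\<phi> d x)"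
        if c': "\<forall>x\<in>topspace X - A. c' x = c x" for c'
      proof -
        have "\<forall>x\<in>topspace X - B. c' x = c0 x" using c' A(2,5) by auto
        then show ?thesis using old[of c'] new[OF c'] by (auto simp: less_Suc_eq)
      qed
      then have "good (Suc N) A c" using A B(2) unfolding good_def by simp
      then show ?case by blast
    qed
    then obtain B c where good: "good N B c" by blast
    show "\<exists>c :: 'x \<Rightarrow> bool. locally_constant X c \<and>
         (\<forall>n<N. \<forall>x\<in>topspace X. \<exists>d\<in>D n. c (\<phi> (d \<otimes> \<gamma> n) x) \<noteq> c (\<phi> d x))"
      by (rule exI[of _ c]) (use good in \<open>simp add: good_def\<close>)
  qed
qed

end

section \<open>Constructions of group actions and zero-dimensional spaces\<close>

text \<open>The action axioms in elementwise form; bijectivity comes from the inverses.\<close>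

lemma group_actionI:
  assumes G: "group G"
    and ext: "\<And>g. g \<in> carrier G \<Longrightarrow> \<phi> g \<in> extensional E"
    and closed: "\<And>g x. g \<in> carrier G \<Longrightarrow> x \<in> E \<Longrightarrow> \<phi> g x \<in> E"
    and one: "\<And>x. x \<in> E \<Longrightarrow> \<phi> \<one>\<^bsub>G\<^esub> x = x"
    and mult: "\<And>g h x. g \<in> carrier G \<Longrightarrow> h \<in> carrier G \<Longrightarrow> x \<in> E \<Longrightarrow> \<phi> (g \<otimes>\<^bsub>G\<^esub> h) x = \<phi> g (\<phi> h x)"
  shows "group_action G E \<phi>"
proof -
  interpret group G by (rule G)
  have bij: "\<phi> g \<in> Bij E" if g: "g \<in> carrier G" for g
  proof -
    have "bij_betw (\<phi> g) E E"
    proof (rule bij_betwI[where g="\<phi> (inv\<^bsub>G\<^esub> g)"])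
      show "\<phi> (inv\<^bsub>G\<^esub> g) (\<phi> g x) = x" if "x \<in> E" for x
        using mult[of "inv\<^bsub>G\<^esub> g" g x] one g that by simp
      show "\<phi> g (\<phi> (inv\<^bsub>G\<^esub> g) x) = x" if "x \<in> E" for x
        using mult[of g "inv\<^bsub>G\<^esub> g" x] one g that by simp
    qed (use g closed in auto)
    then show ?thesis using ext[OF g] by (simp add: Bij_def)
  qed
  have "\<phi> \<in> hom G (BijGroup E)"
  proof (rule homI)
    show "\<phi> g \<in> carrier (BijGroup E)" if "g \<in> carrier G" for g
      using bij[OF that] by (simp add: BijGroup_def)
    show "\<phi> (g \<otimes>\<^bsub>G\<^esub> h) = \<phi> g \<otimes>\<^bsub>BijGroup E\<^esub> \<phi> h" if gh: "g \<in> carrier G" "h \<in> carrier G" for g h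
    proof (rule extensionalityI[of _ E])
      show "\<phi> (g \<otimes>\<^bsub>G\<^esub> h) \<in> extensional E" using ext gh by simp
      show "\<phi> g \<otimes>\<^bsub>BijGroup E\<^esub> \<phi> h \<in> extensional E" using bij gh by (simp add: BijGroup_def)
      show "\<phi> (g \<otimes>\<^bsub>G\<^esub> h) x = (\<phi> g \<otimes>\<^bsub>BijGroup E\<^esub> \<phi> h) x" if "x \<in> E" for x
        using bij gh mult that by (simp add: BijGroup_def compose_eq)
    qed
  qed
  then show ?thesis
    by (intro group_action.intro group_hom.intro group_hom_axioms.intro G group_BijGroup)
qed

lemma gamma_space_iff:
  "gamma_space G X \<phi> \<longleftrightarrow> group_action G (topspace X) \<phi> \<and> (\<forall>g\<in>carrier G. continuous_map X X (\<phi> g))"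
proof -
  have "continuous_map (prod_topology (discrete_topology (carrier G)) X) X (\<lambda>(g, x). \<phi> g x) \<longleftrightarrow>
      (\<forall>g\<in>carrier G. continuous_map X X (\<phi> g))" (is "?L \<longleftrightarrow> ?R")
  proof
    assume L: ?L
    show ?R
    proof
      fix g assume "g \<in> carrier G"
      then have "continuous_map X (prod_topology (discrete_topology (carrier G)) X) (\<lambda>x. (g, x))"
        by (intro continuous_map_pairedI) auto
      from continuous_map_compose[OF this L] show "continuous_map X X (\<phi> g)"
        by (simp add: o_def)
    qed
  next
    assume R: ?R
    show ?L
      unfolding continuous_map
    proof (intro conjI allI impI)
      show "(\<lambda>(g, x). \<phi> g x) ` topspace (prod_topology (discrete_topology (carrier G)) X) \<subseteq> topspace X"
        using R by (auto simp: continuous_map_def)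
      fix U assume U: "openin X U"
      have "{p \<in> topspace (prod_topology (discrete_topology (carrier G)) X). (case p of (g, x) \<Rightarrow> \<phi> g x) \<in> U}
          = (\<Union>g\<in>carrier G. {g} \<times> {x \<in> topspace X. \<phi> g x \<in> U})" by auto
      moreover have "openin (prod_topology (discrete_topology (carrier G)) X)
          ({g} \<times> {x \<in> topspace X. \<phi> g x \<in> U})" if "g \<in> carrier G" for g
        using openin_continuous_map_preimage[OF R[rule_format, OF that] U] that
        by (simp add: openin_prod_Times_iff)
      ultimately show "openin (prod_topology (discrete_topology (carrier G)) X)
          {p \<in> topspace (prod_topology (discrete_topology (carrier G)) X). (case p of (g, x) \<Rightarrow> \<phi> g x) \<in> U}"
        by auto
    qed
  qed
  then show ?thesis unfolding gamma_space_def by simp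
qed

lemma zero_dimensional_spaceI:
  assumes "\<And>U x. openin X U \<Longrightarrow> x \<in> U \<Longrightarrow> \<exists>V. openin X V \<and> closedin X V \<and> x \<in> V \<and> V \<subseteq> U"
  shows "zero_dimensional_space X"
  unfolding zero_dimensional_space_def
proof (intro exI[of _ "{V. openin X V \<and> closedin X V}"] conjI)
  show "openin X = arbitrary union_of (\<lambda>U. U \<in> {V. openin X V \<and> closedin X V})"
    unfolding openin_topology_base_unique[symmetric] using assms
    by (auto simp: openin_topology_base_unique)
qed auto

lemma separable_metrizable_imp_second_countable:
  assumes "separable_space X" "metrizable_space X"
  shows "second_countable X"
proof -
  obtain M d where "Metric_space M d" and X: "X = Metric_space.mtopology M d"
    using assms(2) by (auto simp: metrizable_space_def)
  interpret Metric_space M d by fact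
  obtain C where C: "countable C" "C \<subseteq> M" "mtopology closure_of C = M"
    using assms(1) by (auto simp: separable_space_def X)
  have dense: "\<exists>y\<in>C. y \<in> mball x r" if "x \<in> M" "r > 0" for x r
    using that C(3) unfolding metric_closure_of by auto
  show ?thesis
    unfolding second_countable_def X
  proof (intro exI conjI)
    show "countable ((\<lambda>(c, n). mball c (1 / real (Suc n))) ` (C \<times> UNIV))"
      using C(1) by (intro countable_image countable_SIGMA) auto
    show "\<forall>V\<in>(\<lambda>(c, n). mball c (1 / real (Suc n))) ` (C \<times> UNIV). openin mtopology V" by auto
    show "\<forall>U x. openin mtopology U \<and> x \<in> U \<longrightarrow>
        (\<exists>V\<in>(\<lambda>(c, n). mball c (1 / real (Suc n))) ` (C \<times> UNIV). x \<in> V \<and> V \<subseteq> U)"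
    proof (intro allI impI, elim conjE)
      fix U x assume U: "openin mtopology U" "x \<in> U"
      then obtain r where r: "r > 0" "mball x r \<subseteq> U" and xM: "x \<in> M"
        unfolding openin_mtopology by blast
      obtain n where n: "1 / real (Suc n) < r / 2"
        using r(1) nat_approx_posE[of "r / 2"] by auto
      obtain c where c: "c \<in> C" "c \<in> mball x (1 / real (Suc n))"
        using dense[OF xM, of "1 / real (Suc n)"] by auto
      have "x \<in> mball c (1 / real (Suc n))" using c(2) by (simp add: commute in_mball)
      moreover have "mball c (1 / real (Suc n)) \<subseteq> U"
      proof
        fix y assume y: "y \<in> mball c (1 / real (Suc n))"
        have "d x y \<le> d x c + d c y" using y c xM by (intro triangle) auto
        then have "d x y < r" using y c n by auto
        then show "y \<in> U" using r(2) xM y by auto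
      qed
      ultimately show "\<exists>V\<in>(\<lambda>(c, n). mball c (1 / real (Suc n))) ` (C \<times> UNIV). x \<in> V \<and> V \<subseteq> U"
        using c(1) by (intro bexI[of _ "mball c (1 / real (Suc n))"]) auto
    qed
  qed
qed

lemma free_zd_gspaceI:
  assumes "gamma_space G X \<phi>" "free_action_on G (topspace X) \<phi>"
    and "zero_dimensional_space X" "Polish_space X"
  shows "free_zd_gspace G X \<phi>"
proof -
  have met: "metrizable_space X" and sep: "separable_space X"
    using assms(4) by (auto simp: Polish_space_def completely_metrizable_imp_metrizable_space)
  interpret group_action G "topspace X" \<phi> using assms(1) by (simp add: gamma_space_iff)
  show ?thesis
  proof
    show "continuous_map X X (\<phi> g)" if "g \<in> carrier G" for g
      using assms(1) that by (simp add: gamma_space_iff)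
    show "g = \<one>\<^bsub>G\<^esub>" if "g \<in> carrier G" "x \<in> topspace X" "\<phi> g x = x" for g x
      using assms(2) that unfolding free_action_on_def stabilizer_def by blast
    show "Lindelof_space X"
      using separable_metrizable_imp_second_countable[OF sep met]
      by (rule second_countable_imp_Lindelof_space)
    show "Hausdorff_space X" using met by (rule metrizable_imp_Hausdorff_space)
  qed (rule assms(3))
qed

lemma gamma_space_subtopology:
  assumes "gamma_space G X \<phi>" "S \<subseteq> topspace X"
    and inv: "\<And>g x. g \<in> carrier G \<Longrightarrow> x \<in> S \<Longrightarrow> \<phi> g x \<in> S"
  shows "gamma_space G (subtopology X S) (\<lambda>g. restrict (\<phi> g) S)"
proof -
  interpret group_action G "topspace X" \<phi> using assms(1) by (simp add: gamma_space_iff)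
  have S: "topspace (subtopology X S) = S" using assms(2) by auto
  have G: "group G" using group_hom group_hom.axioms(1) by blast
  have one: "\<phi> \<one>\<^bsub>G\<^esub> x = x" if "x \<in> topspace X" for x
    using id_eq_one that by (metis restrict_apply')
  have "group_action G S (\<lambda>g. restrict (\<phi> g) S)"
    by (rule group_actionI) (use G inv one composition_rule assms(2) in \<open>auto simp: subset_eq\<close>)
  moreover have "continuous_map (subtopology X S) (subtopology X S) (restrict (\<phi> g) S)" if g: "g \<in> carrier G" for g
  proof (rule continuous_map_eq)
    show "continuous_map (subtopology X S) (subtopology X S) (\<phi> g)"
      using assms(1) g inv
      by (auto simp: gamma_space_iff continuous_map_in_subtopology S intro: continuous_map_from_subtopology)
  qed (simp add: S)
  ultimately show ?thesis unfolding gamma_space_iff S by blast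
qed

lemma gamma_space_homeomorphic:
  assumes X: "gamma_space G X \<phi>" and j: "homeomorphic_maps X Y j i"
  shows "gamma_space G Y (\<lambda>g. \<lambda>y\<in>topspace Y. j (\<phi> g (i y)))"
proof -
  interpret group_action G "topspace X" \<phi> using X by (simp add: gamma_space_iff)
  have G: "group G" using group_hom group_hom.axioms(1) by blast
  have one: "\<phi> \<one>\<^bsub>G\<^esub> x = x" if "x \<in> topspace X" for x
    using id_eq_one that by (metis restrict_apply')
  have cj: "continuous_map X Y j" and ci: "continuous_map Y X i"
    and ij: "\<And>x. x \<in> topspace X \<Longrightarrow> i (j x) = x" and ji: "\<And>y. y \<in> topspace Y \<Longrightarrow> j (i y) = y"
    using j by (auto simp: homeomorphic_maps_def)
  have iY: "i y \<in> topspace X" if "y \<in> topspace Y" for y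
    using ci that by (auto simp: continuous_map_def)
  have jX: "j x \<in> topspace Y" if "x \<in> topspace X" for x
    using cj that by (auto simp: continuous_map_def)
  have act: "\<phi> g x \<in> topspace X" if "g \<in> carrier G" "x \<in> topspace X" for g x
    using that element_image by blast
  have "group_action G (topspace Y) (\<lambda>g. \<lambda>y\<in>topspace Y. j (\<phi> g (i y)))"
    by (rule group_actionI[OF G]) (use one composition_rule ij ji iY jX act group.is_monoid[OF G] in auto)
  moreover have "continuous_map Y Y (\<lambda>y\<in>topspace Y. j (\<phi> g (i y)))" if g: "g \<in> carrier G" for g
  proof (rule continuous_map_eq)
    have "continuous_map X X (\<phi> g)" using X g by (simp add: gamma_space_iff)
    from continuous_map_compose[OF continuous_map_compose[OF ci this] cj]
    show "continuous_map Y Y (j \<circ> (\<phi> g \<circ> i))" .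
  qed simp
  ultimately show ?thesis unfolding gamma_space_iff by blast
qed

lemma zero_dimensional_space_subtopology:
  assumes "zero_dimensional_space X"
  shows "zero_dimensional_space (subtopology X S)"
proof (rule zero_dimensional_spaceI)
  fix U x assume "openin (subtopology X S) U" "x \<in> U"
  then obtain W where W: "openin X W" "U = W \<inter> S" by (auto simp: openin_subtopology)
  then obtain V where V: "openin X V" "closedin X V" "x \<in> V" "V \<subseteq> W"
    using zero_dimensional_space_clopen_nbhd[OF assms W(1)] \<open>x \<in> U\<close> by (metis IntD1)
  show "\<exists>V. openin (subtopology X S) V \<and> closedin (subtopology X S) V \<and> x \<in> V \<and> V \<subseteq> U"
    by (rule exI[of _ "V \<inter> S"])
      (use V W \<open>x \<in> U\<close> in \<open>auto simp: openin_subtopology closedin_subtopology\<close>)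
qed

lemma zero_dimensional_space_homeomorphic:
  assumes "zero_dimensional_space X" "homeomorphic_maps X Y j i"
  shows "zero_dimensional_space Y"
proof (rule zero_dimensional_spaceI)
  have cj: "continuous_map X Y j" and ci: "continuous_map Y X i"
    and ji: "\<And>y. y \<in> topspace Y \<Longrightarrow> j (i y) = y"
    using assms(2) by (auto simp: homeomorphic_maps_def)
  fix U y assume U: "openin Y U" "y \<in> U"
  then have y: "y \<in> topspace Y" using openin_subset by blast
  then have "i y \<in> topspace X" using ci by (auto simp: continuous_map_def)
  moreover have "openin X {x \<in> topspace X. j x \<in> U}" using cj U by (simp add: openin_continuous_map_preimage)
  ultimately obtain V where V: "openin X V" "closedin X V" "i y \<in> V" "V \<subseteq> {x \<in> topspace X. j x \<in> U}"
    using zero_dimensional_space_clopen_nbhd[OF assms(1)] U ji[OF y] by (metis (no_types, lifting) mem_Collect_eq)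
  show "\<exists>V. openin Y V \<and> closedin Y V \<and> y \<in> V \<and> V \<subseteq> U"
  proof (intro exI[of _ "{z \<in> topspace Y. i z \<in> V}"] conjI)
    show "openin Y {z \<in> topspace Y. i z \<in> V}" using ci V by (simp add: openin_continuous_map_preimage)
    show "closedin Y {z \<in> topspace Y. i z \<in> V}" using ci V by (simp add: closedin_continuous_map_preimage)
    show "{z \<in> topspace Y. i z \<in> V} \<subseteq> U" using V(4) ji by force
  qed (use V y in auto)
qed

section \<open>The shift and its free part\<close>

lemma locally_constant_into:
  assumes "locally_constant X f" "\<And>x. x \<in> topspace X \<Longrightarrow> f x \<in> S"
  shows "continuous_map X (discrete_topology S) f"
  using assms by (auto simp: continuous_map_def)

lemma locally_constant_from_discrete:
  assumes "continuous_map X (discrete_topology S) f"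
  shows "locally_constant X f"
  using continuous_map_compose[OF assms, of "discrete_topology UNIV" id] by simp

lemma topspace_shift_space: "topspace (shift_space G) = (\<Pi>\<^sub>E d\<in>carrier G. {..<2})"
  by (simp add: shift_space_def)

lemma shift_action_apply:
  assumes "z \<in> topspace (shift_space G)" "d \<in> carrier G"
  shows "shift_action G g z d = z (d \<otimes>\<^bsub>G\<^esub> g)"
  using assms by (simp add: shift_action_def)

lemma locally_constant_coordinate:
  assumes "d \<in> carrier G"
  shows "locally_constant (shift_space G) (\<lambda>z. z d)"
  by (rule locally_constant_from_discrete[of _ "{..<2}"])
    (unfold shift_space_def, rule continuous_map_product_projection[OF assms])

text \<open>Agreement on a finite window is the basic neighborhood; it is clopen, and countably many such
sets suffice when the group is countable.\<close>

lemma shift_space_cylinder: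
  assumes U: "openin (shift_space G) U" "z \<in> U"
  obtains F where "finite F" "F \<subseteq> carrier G" "{y \<in> topspace (shift_space G). \<forall>d\<in>F. y d = z d} \<subseteq> U"
proof -
  obtain W where W: "finite {d \<in> carrier G. W d \<noteq> {..<2::nat}}" "z \<in> Pi\<^sub>E (carrier G) W"
      "Pi\<^sub>E (carrier G) W \<subseteq> U"
    using U unfolding shift_space_def openin_product_topology_alt topspace_discrete_topology by metis
  show ?thesis
  proof (rule that[OF W(1)])
    show "{y \<in> topspace (shift_space G). \<forall>d\<in>{d \<in> carrier G. W d \<noteq> {..<2}}. y d = z d} \<subseteq> U"
    proof
      fix y assume y: "y \<in> {y \<in> topspace (shift_space G). \<forall>d\<in>{d \<in> carrier G. W d \<noteq> {..<2}}. y d = z d}"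
      have "y d \<in> W d" if "d \<in> carrier G" for d
      proof (cases "W d = {..<2}")
        case True
        then show ?thesis using y that by (auto simp: topspace_shift_space)
      next
        case False
        then have "y d = z d" using y that by auto
        then show ?thesis using W(2) that by auto
      qed
      moreover have "y \<in> extensional (carrier G)" using y by (simp add: topspace_shift_space PiE_def)
      ultimately have "y \<in> Pi\<^sub>E (carrier G) W" by (simp add: PiE_def)
      then show "y \<in> U" using W(3) by auto
    qed
  qed auto
qed

lemma zero_dimensional_shift_space: "zero_dimensional_space (shift_space G)"
proof (rule zero_dimensional_spaceI)
  fix U z assume U: "openin (shift_space G) U" "z \<in> U"
  then obtain F where F: "finite F" "F \<subseteq> carrier G"
      "{y \<in> topspace (shift_space G). \<forall>d\<in>F. y d = z d} \<subseteq> U"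
    by (rule shift_space_cylinder)
  define V where "V = {y \<in> topspace (shift_space G). \<forall>d\<in>F. y d = z d}"
  have "locally_constant (shift_space G) (\<lambda>y. \<forall>d\<in>F. y d = z d)"
    using F(2) by (intro locally_constant_Ball[OF F(1)] locally_constant_comp[where h="\<lambda>a. a = z d" for d]
        locally_constant_coordinate) auto
  then have "locally_constant (shift_space G) (\<lambda>y. y \<in> V)"
    by (rule locally_constant_cong) (simp add: V_def)
  moreover have "topspace (shift_space G) \<inter> V = V" by (auto simp: V_def)
  ultimately have "openin (shift_space G) V" "closedin (shift_space G) V"
    unfolding locally_constant_clopen by simp_all
  moreover have "z \<in> V" using U openin_subset by (auto simp: V_def)
  ultimately show "\<exists>V. openin (shift_space G) V \<and> closedin (shift_space G) V \<and> z \<in> V \<and> V \<subseteq> U"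
    using F(3) unfolding V_def by blast
qed

lemma compact_shift_space: "compact_space (shift_space G)"
  unfolding shift_space_def by (simp add: compact_space_product_topology compact_space_discrete_topology)

lemma completely_metrizable_shift_space:
  assumes "countable (carrier G)"
  shows "completely_metrizable_space (shift_space G)"
  unfolding shift_space_def completely_metrizable_space_product_topology
  by (intro disjI2 conjI ballI completely_metrizable_space_discrete_topology
      countable_subset[OF _ assms]) auto

lemma second_countable_shift_space:
  assumes "countable (carrier G)"
  shows "second_countable (shift_space G)"
proof -
  define \<F> where "\<F> = {F. finite F \<and> F \<subseteq> carrier G}"
  define cyl where "cyl = (\<lambda>(F, W). {y \<in> topspace (shift_space G). {d \<in> F. y d = 1} = W})"
  show ?thesis
    unfolding second_countable_def
  proof (intro exI[of _ "cyl ` (\<F> \<times> \<F>)"] conjI ballI allI impI)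
    have "countable \<F>" unfolding \<F>_def by (rule countable_Collect_finite_subset[OF assms])
    then show "countable (cyl ` (\<F> \<times> \<F>))" by blast
    show "openin (shift_space G) V" if V: "V \<in> cyl ` (\<F> \<times> \<F>)" for V
    proof -
      obtain F W where FW: "F \<in> \<F>" "V = cyl (F, W)" using V by auto
      have "locally_constant (shift_space G) (\<lambda>y. {d \<in> F. y d = 1})"
        using FW(1) by (intro locally_constant_Collect locally_constant_comp[where h="\<lambda>a. a = 1"]
            locally_constant_coordinate) (auto simp: \<F>_def)
      then show ?thesis unfolding locally_constant_iff FW(2) cyl_def by simp
    qed
    fix U z assume "openin (shift_space G) U \<and> z \<in> U"
    then have U: "openin (shift_space G) U" "z \<in> U" by auto
    then obtain F where F: "finite F" "F \<subseteq> carrier G"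
        "{y \<in> topspace (shift_space G). \<forall>d\<in>F. y d = z d} \<subseteq> U"
      by (rule shift_space_cylinder)
    have z: "z \<in> topspace (shift_space G)" using U openin_subset by blast
    define W where "W = {d \<in> F. z d = 1}"
    have "y d = z d" if "y \<in> cyl (F, W)" "d \<in> F" for y d
    proof -
      have "y d < 2" "z d < 2" "y d = 1 \<longleftrightarrow> z d = 1"
        using that z F(2) by (auto simp: cyl_def W_def topspace_shift_space)
      then show ?thesis by linarith
    qed
    then have "cyl (F, W) \<subseteq> U" using F(3) by (auto simp: cyl_def)
    moreover have "z \<in> cyl (F, W)" using z by (simp add: cyl_def W_def)
    moreover have "(F, W) \<in> \<F> \<times> \<F>" using F by (auto simp: \<F>_def W_def)
    ultimately show "\<exists>V\<in>cyl ` (\<F> \<times> \<F>). z \<in> V \<and> V \<subseteq> U" by blast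
  qed
qed

text \<open>Only an injection is used: the topology is pulled back and has nothing to do with the usual
topology of the reals.\<close>

lemma homeomorphic_copy_in_reals:
  fixes X :: "'x topology" and h :: "'x \<Rightarrow> real"
  assumes "inj_on h (topspace X)"
  obtains Y i where "homeomorphic_maps X (Y :: real topology) h i"
proof -
  define i where "i = inv_into (topspace X) h"
  define Y where "Y = pullback_topology (h ` topspace X) i X"
  have ih: "i (h x) = x" if "x \<in> topspace X" for x using assms that by (simp add: i_def)
  have Y: "topspace Y = h ` topspace X"
    unfolding Y_def topspace_pullback_topology using ih by auto
  have "homeomorphic_maps X Y h i"
    unfolding homeomorphic_maps_def
  proof (intro conjI ballI)
    show "continuous_map X Y h"
      unfolding continuous_map
    proof (intro conjI allI impI)
      fix U assume "openin Y U"
      then obtain V where V: "openin X V" "U = i -` V \<inter> h ` topspace X"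
        unfolding Y_def openin_pullback_topology by blast
      have "h x \<in> U \<longleftrightarrow> x \<in> V" if "x \<in> topspace X" for x using V(2) ih[OF that] that by simp
      then have "{x \<in> topspace X. h x \<in> U} = V" using openin_subset[OF V(1)] by blast
      then show "openin X {x \<in> topspace X. h x \<in> U}" using V(1) by simp
    qed (simp add: Y)
    show "continuous_map Y X i"
      unfolding continuous_map
    proof (intro conjI allI impI)
      fix U assume "openin X U"
      then show "openin Y {y \<in> topspace Y. i y \<in> U}"
        unfolding Y_def openin_pullback_topology by (intro exI[of _ U]) (use Y Y_def in auto)
    qed (use ih in \<open>auto simp: Y\<close>)
  qed (use ih Y in auto)
  then show ?thesis by (rule that)
qed

lemma inj_on_shift_space_reals:
  assumes "countable (carrier G)"
  obtains h :: "('g \<Rightarrow> nat) \<Rightarrow> real" where "inj_on h (topspace (shift_space (G :: ('g, 'm) monoid_scheme)))"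
proof -
  obtain b :: "nat set \<Rightarrow> real" where b: "inj b"
    using nat_sets_eqpoll_reals unfolding eqpoll_def bij_betw_def by blast
  define s where "s z = to_nat_on (carrier G) ` {d \<in> carrier G. z d = (1::nat)}" for z
  have "inj_on s (topspace (shift_space G))"
  proof (rule inj_onI)
    fix y z assume yz: "y \<in> topspace (shift_space G)" "z \<in> topspace (shift_space G)" "s y = s z"
    then have "{d \<in> carrier G. y d = 1} = {d \<in> carrier G. z d = 1}"
      unfolding s_def using assms inj_on_image_eq_iff[OF inj_on_to_nat_on[OF assms]] by auto
    then have ones: "y d = 1 \<longleftrightarrow> z d = 1" if "d \<in> carrier G" for d using that by blast
    have "y d = z d" if d: "d \<in> carrier G" for d
    proof -
      have "y d < 2" "z d < 2" using yz d by (auto simp: topspace_shift_space)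
      then show ?thesis using ones[OF d] by linarith
    qed
    then show "y = z"
      using yz by (intro extensionalityI[of y "carrier G" z]) (auto simp: topspace_shift_space PiE_def)
  qed
  then have "inj_on (b \<circ> s) (topspace (shift_space G))"
    using b by (intro comp_inj_on) (auto intro: inj_on_subset)
  then show ?thesis by (rule that)
qed

lemma admits_homeomorphic:
  assumes gs: "gamma_space G X \<phi>" and j: "homeomorphic_maps X Y j i"
    and P: "\<And>p. p \<in> P \<Longrightarrow> dom p \<subseteq> carrier G"
    and adm: "admits_continuous_avoiding_coloring k P Y (\<lambda>g. \<lambda>y\<in>topspace Y. j (\<phi> g (i y)))"
  shows "admits_continuous_avoiding_coloring k P X \<phi>"
proof -
  have cj: "continuous_map X Y j" and ij: "\<And>x. x \<in> topspace X \<Longrightarrow> i (j x) = x"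
    using j by (auto simp: homeomorphic_maps_def)
  obtain f where f: "continuous_map Y (discrete_topology {..<k}) f"
    and av: "avoiding P Y (\<lambda>g. \<lambda>y\<in>topspace Y. j (\<phi> g (i y))) f"
    using adm by (auto simp: admits_continuous_avoiding_coloring_def)
  have "avoiding P X \<phi> (f \<circ> j)"
    unfolding avoiding_def occurs_in_def
  proof (intro ballI notI, elim bexE)
    fix p x assume p: "p \<in> P" and x: "x \<in> topspace X" and occ: "\<forall>g\<in>dom p. p g = Some ((f \<circ> j) (\<phi> g x))"
    have "j x \<in> topspace Y" using cj x by (auto simp: continuous_map_def)
    then have "occurs_in p Y (\<lambda>g. \<lambda>y\<in>topspace Y. j (\<phi> g (i y))) f"
      unfolding occurs_in_def using occ ij[OF x] by (intro bexI[of _ "j x"]) auto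
    then show False using av p by (auto simp: avoiding_def)
  qed
  then show ?thesis
    unfolding admits_continuous_avoiding_coloring_def using continuous_map_compose[OF cj f] by blast
qed

context group
begin

lemma gamma_space_shift: "gamma_space G (shift_space G) (shift_action G)"
proof -
  have closed: "shift_action G g z \<in> topspace (shift_space G)"
    if "g \<in> carrier G" "z \<in> topspace (shift_space G)" for g z
    using that by (auto simp: shift_action_def topspace_shift_space PiE_iff)
  have "group_action G (topspace (shift_space G)) (shift_action G)"
  proof (rule group_actionI)
    show "group G" by (rule group_axioms)
    show "shift_action G g \<in> extensional (topspace (shift_space G))" for g
      by (simp add: shift_action_def)
    show "shift_action G \<one> z = z" if "z \<in> topspace (shift_space G)" for z
      using that by (intro extensionalityI[of _ "carrier G"])
        (auto simp: shift_action_def topspace_shift_space PiE_def)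
    show "shift_action G (g \<otimes> h) z = shift_action G g (shift_action G h z)"
      if "g \<in> carrier G" "h \<in> carrier G" "z \<in> topspace (shift_space G)" for g h z
      using that closed
      by (intro extensionalityI[of _ "carrier G"]) (auto simp: shift_action_def m_assoc)
  qed (rule closed)
  moreover have "continuous_map (shift_space G) (shift_space G) (shift_action G g)" if g: "g \<in> carrier G" for g
  proof -
    have "continuous_map (shift_space G) (discrete_topology {..<2}) (\<lambda>z. shift_action G g z d)"
      if d: "d \<in> carrier G" for d
    proof (rule locally_constant_into)
      have "locally_constant (shift_space G) (\<lambda>z. z (d \<otimes> g))"
        using d g by (intro locally_constant_coordinate) simp
      then show "locally_constant (shift_space G) (\<lambda>z. shift_action G g z d)"
        by (rule locally_constant_cong) (simp add: shift_action_apply d)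
      show "shift_action G g z d \<in> {..<2}" if "z \<in> topspace (shift_space G)" for z
        using closed[OF g that] d by (auto simp: topspace_shift_space)
    qed
    then show ?thesis
      unfolding shift_space_def[of G] continuous_map_componentwise
      using closed[OF g] by (auto simp: shift_space_def[symmetric] topspace_shift_space PiE_def)
  qed
  ultimately show ?thesis by (simp add: gamma_space_iff)
qed

lemma shift_closed:
  "g \<in> carrier G \<Longrightarrow> z \<in> topspace (shift_space G) \<Longrightarrow> shift_action G g z \<in> topspace (shift_space G)"
  using gamma_space_shift group_action.element_image by (fastforce simp: gamma_space_iff)

lemma shift_mult:
  "g \<in> carrier G \<Longrightarrow> h \<in> carrier G \<Longrightarrow> z \<in> topspace (shift_space G) \<Longrightarrow>
    shift_action G (g \<otimes> h) z = shift_action G g (shift_action G h z)"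
  using gamma_space_shift group_action.composition_rule by (fastforce simp: gamma_space_iff)

lemma shift_one: "z \<in> topspace (shift_space G) \<Longrightarrow> shift_action G \<one> z = z"
  using gamma_space_shift group_action.id_eq_one by (metis gamma_space_iff restrict_apply')

lemma free_part_iff:
  "z \<in> free_part G \<longleftrightarrow> z \<in> topspace (shift_space G) \<and> (\<forall>g\<in>carrier G. shift_action G g z = z \<longrightarrow> g = \<one>)"
  using shift_one by (auto simp: free_part_def stabilizer_def)

lemma shift_free_part:
  assumes g: "g \<in> carrier G" and z: "z \<in> free_part G"
  shows "shift_action G g z \<in> free_part G"
proof -
  have zY: "z \<in> topspace (shift_space G)" using z by (simp add: free_part_iff)
  have "h = \<one>" if h: "h \<in> carrier G" and hfix: "shift_action G h (shift_action G g z) = shift_action G g z" for h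
  proof -
    have "shift_action G (inv g \<otimes> (h \<otimes> g)) z = shift_action G (inv g) (shift_action G h (shift_action G g z))"
      using g h zY by (simp add: shift_mult shift_closed)
    also have "\<dots> = shift_action G (inv g \<otimes> g) z"
      unfolding hfix using shift_mult[of "inv g" g z] g zY by simp
    finally have "shift_action G (inv g \<otimes> (h \<otimes> g)) z = z" using g zY by (simp add: shift_one)
    then have "inv g \<otimes> (h \<otimes> g) = \<one>" using z g h by (simp add: free_part_iff)
    then have "h \<otimes> g = g" using g h by (metis inv_closed inv_equality inv_inv m_closed)
    then show ?thesis using g h by simp
  qed
  then show ?thesis using shift_closed[OF g zY] by (simp add: free_part_iff)
qed

lemma topspace_free_part_space: "topspace (free_part_space G) = free_part G"
  by (auto simp: free_part_space_def free_part_iff)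

lemma gamma_space_free_part: "gamma_space G (free_part_space G) (free_part_action G)"
  unfolding free_part_space_def free_part_action_def
  by (rule gamma_space_subtopology[OF gamma_space_shift _ shift_free_part]) (auto simp: free_part_iff)

text \<open>The free part is the intersection, over the countably many \<open>g \<noteq> \<one>\<close>, of the open sets of points
moved by \<open>g\<close>. It is thus a \<open>G_delta\<close> set in a compact metrizable space.\<close>

lemma Polish_space_free_part:
  assumes count: "countable (carrier G)" and inf: "infinite (carrier G)"
  shows "Polish_space (free_part_space G)"
  unfolding Polish_space_def
proof
  show "separable_space (free_part_space G)"
    unfolding free_part_space_def
    by (intro second_countable_imp_separable_space second_countable_subtopology
        second_countable_shift_space count)
  define U where "U g = {z \<in> topspace (shift_space G). shift_action G g z \<noteq> z}" for g
  have "openin (shift_space G) (U g)" if g: "g \<in> carrier G" for g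
  proof -
    have "U g = (\<Union>d\<in>carrier G. {z \<in> topspace (shift_space G). z (d \<otimes> g) \<noteq> z d})"
    proof
      show "U g \<subseteq> (\<Union>d\<in>carrier G. {z \<in> topspace (shift_space G). z (d \<otimes> g) \<noteq> z d})"
      proof
        fix z assume z: "z \<in> U g"
        then have zY: "z \<in> topspace (shift_space G)" by (simp add: U_def)
        have "\<exists>d\<in>carrier G. z (d \<otimes> g) \<noteq> z d"
        proof (rule ccontr)
          assume "\<not> ?thesis"
          then have "shift_action G g z = z"
            using zY shift_closed[OF g zY]
            by (intro extensionalityI[of _ "carrier G"])
              (auto simp: shift_action_apply topspace_shift_space PiE_def)
          then show False using z by (simp add: U_def)
        qed
        then show "z \<in> (\<Union>d\<in>carrier G. {z \<in> topspace (shift_space G). z (d \<otimes> g) \<noteq> z d})"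
          using zY by blast
      qed
    qed (use g in \<open>auto simp: U_def dest: shift_action_apply[of _ G _ g]\<close>)
    moreover have "openin (shift_space G) {z \<in> topspace (shift_space G). z (d \<otimes> g) \<noteq> z d}"
      if d: "d \<in> carrier G" for d
    proof -
      have "locally_constant (shift_space G) (\<lambda>z. z (d \<otimes> g) \<noteq> z d)"
        by (rule locally_constant_comp2[where h="(\<noteq>)"]; rule locally_constant_coordinate) (use d g in auto)
      then have "openin (shift_space G) {z \<in> topspace (shift_space G). (z (d \<otimes> g) \<noteq> z d) = True}"
        unfolding locally_constant_iff by blast
      then show ?thesis by simp
    qed
    ultimately show ?thesis by auto
  qed
  moreover have "countable (U ` (carrier G - {\<one>}))" using count by auto
  moreover have "\<Inter>(U ` (carrier G - {\<one>})) = free_part G"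
  proof -
    have "carrier G - {\<one>} \<noteq> {}" using inf by (metis finite.emptyI finite_Diff_insert Diff_empty)
    then show ?thesis by (auto simp: U_def free_part_iff)
  qed
  ultimately have "(countable intersection_of openin (shift_space G)) (free_part G)"
    unfolding intersection_of_def by (intro exI[of _ "U ` (carrier G - {\<one>})"]) auto
  then show "completely_metrizable_space (free_part_space G)"
    unfolding free_part_space_def
    by (rule completely_metrizable_space_gdelta_in_alt[OF completely_metrizable_shift_space[OF count]])
qed

lemma admits_free_part_if_all_real:
  assumes count: "countable (carrier G)" and inf: "infinite (carrier G)"
    and P: "\<forall>p\<in>P. is_pattern G k p"
    and all: "all_free_zd_Polish_spaces_admit TYPE(real) G k P"
  shows "admits_continuous_avoiding_coloring k P (free_part_space G) (free_part_action G)"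
proof -
  obtain h :: "('a \<Rightarrow> nat) \<Rightarrow> real" where h: "inj_on h (topspace (shift_space G))"
    using inj_on_shift_space_reals[OF count] by blast
  have "inj_on h (topspace (free_part_space G))"
    by (rule inj_on_subset[OF h]) (auto simp: topspace_free_part_space free_part_iff)
  then obtain Y i where Y: "homeomorphic_maps (free_part_space G) (Y :: real topology) h i"
    by (rule homeomorphic_copy_in_reals)
  define \<psi> where "\<psi> = (\<lambda>g. \<lambda>y\<in>topspace Y. h (free_part_action G g (i y)))"
  have gs: "gamma_space G Y \<psi>"
    unfolding \<psi>_def by (rule gamma_space_homeomorphic[OF gamma_space_free_part Y])
  have ih: "\<And>x. x \<in> topspace (free_part_space G) \<Longrightarrow> i (h x) = x"
    and iY: "\<And>y. y \<in> topspace Y \<Longrightarrow> i y \<in> topspace (free_part_space G)"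
    using Y by (auto simp: homeomorphic_maps_def continuous_map_def)
  have "stabilizer G \<psi> y = {\<one>}" if y: "y \<in> topspace Y" for y
  proof -
    have iy: "i y \<in> free_part G" using iY[OF y] by (simp add: topspace_free_part_space)
    have "g = \<one>" if g: "g \<in> carrier G" "\<psi> g y = y" for g
    proof -
      have "i (h (shift_action G g (i y))) = i y"
        using g(2) y iy by (simp add: \<psi>_def free_part_action_def)
      then have "shift_action G g (i y) = i y"
        using ih shift_free_part[OF g(1) iy] by (simp add: topspace_free_part_space)
      then show ?thesis using iy g(1) by (simp add: free_part_iff)
    qed
    moreover have "\<psi> \<one> y = y"
      using gs y group_action.id_eq_one by (metis gamma_space_iff restrict_apply')
    ultimately show ?thesis by (auto simp: stabilizer_def)
  qed
  then have "free_action_on G (topspace Y) \<psi>" by (simp add: free_action_on_def)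
  moreover have "zero_dimensional_space Y"
    using Y unfolding free_part_space_def
    by (rule zero_dimensional_space_homeomorphic[OF zero_dimensional_space_subtopology[OF zero_dimensional_shift_space]])
  moreover have "Polish_space Y"
    using Polish_space_free_part[OF count inf] Y homeomorphic_completely_metrizable_space
      homeomorphic_separable_space homeomorphic_space_def unfolding Polish_space_def by metis
  ultimately have "admits_continuous_avoiding_coloring k P Y \<psi>"
    using all gs unfolding all_free_zd_Polish_spaces_admit_def by blast
  then show ?thesis
    unfolding \<psi>_def using P
    by (intro admits_homeomorphic[OF gamma_space_free_part Y]) (auto simp: is_pattern_def)
qed

text \<open>Compactness replaces the missing equivariant map from \<open>X\<close> to the free part. The set \<open>S_all\<close> of
points that satisfy all separation requirements is compact and contained in the free part, so \<open>f\<close>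
restricted to it extends to a continuous coloring \<open>f'\<close> of the whole shift. Occurrence of a
pattern in \<open>f'\<close> is a clopen condition that is disjoint from \<open>S_all\<close>, hence already from the set \<open>S N\<close>
given by finitely many requirements. A coloring of \<open>X\<close> that meets these defines an
equivariant map to \<open>S N\<close>, along which \<open>f'\<close> is pulled back.\<close>

lemma admits_if_admits_free_part:
  fixes X :: "'x topology"
  assumes count: "countable (carrier G)" and inf: "infinite (carrier G)"
    and k: "k \<ge> 1" and finP: "finite P" and P: "\<forall>p\<in>P. is_pattern G k p"
    and adm: "admits_continuous_avoiding_coloring k P (free_part_space G) (free_part_action G)"
    and X: "free_zd_gspace G X \<phi>"
  shows "admits_continuous_avoiding_coloring k P X \<phi>"
proof -
  let ?Y = "shift_space G"
  interpret X: free_zd_gspace G X \<phi> by (rule X)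
  obtain f where f: "continuous_map (free_part_space G) (discrete_topology {..<k}) f"
    and av: "avoiding P (free_part_space G) (free_part_action G) f"
    using adm by (auto simp: admits_continuous_avoiding_coloring_def)
  have domP: "finite (dom p)" "dom p \<subseteq> carrier G" if "p \<in> P" for p
    using P that by (auto simp: is_pattern_def)

  define \<gamma> where "\<gamma> = from_nat_into (carrier G - {\<one>})"
  have ne: "carrier G - {\<one>} \<noteq> {}" using inf by (metis finite.emptyI finite_Diff_insert Diff_empty)
  have rg: "range \<gamma> = carrier G - {\<one>}"
    unfolding \<gamma>_def using ne count by (intro range_from_nat_into) auto
  have gam: "\<gamma> n \<in> carrier G" "\<gamma> n \<noteq> \<one>" for n using rg by (metis Diff_iff rangeI singletonI)+
  obtain D :: "nat \<Rightarrow> 'a set" where D: "\<And>n. finite (D n)" "\<And>n. D n \<subseteq> carrier G"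
    and sep: "\<And>(X :: 'x topology) \<phi> N. free_zd_gspace G X \<phi> \<Longrightarrow>
       \<exists>c :: 'x \<Rightarrow> bool. locally_constant X c \<and>
         (\<forall>n<N. \<forall>x\<in>topspace X. \<exists>d\<in>D n. c (\<phi> (d \<otimes> \<gamma> n) x) \<noteq> c (\<phi> d x))"
    by (rule uniform_separating_colorings[of \<gamma>, OF inf gam, where ?'x = 'x]) (rule that; assumption)
  have DG: "d \<in> carrier G" if "d \<in> D n" for d n using D(2) that by blast

  define S where "S N = {z \<in> topspace ?Y. \<forall>n<N. \<forall>h\<in>carrier G. \<exists>d\<in>D n. z (d \<otimes> \<gamma> n \<otimes> h) \<noteq> z (d \<otimes> h)}" for N
  have S_closed: "closedin ?Y (S N)" for N
  proof -
    have "openin ?Y {z \<in> topspace ?Y. \<forall>d\<in>D n. z (d \<otimes> \<gamma> n \<otimes> h) = z (d \<otimes> h)}" if h: "h \<in> carrier G" for n h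
    proof -
      have "locally_constant ?Y (\<lambda>z. \<forall>d\<in>D n. z (d \<otimes> \<gamma> n \<otimes> h) = z (d \<otimes> h))"
        by (rule locally_constant_Ball[OF D(1)], rule locally_constant_comp2[where h="(=)"];
            rule locally_constant_coordinate) (use DG gam h in auto)
      then have "openin ?Y {z \<in> topspace ?Y. (\<forall>d\<in>D n. z (d \<otimes> \<gamma> n \<otimes> h) = z (d \<otimes> h)) = True}"
        unfolding locally_constant_iff by blast
      then show ?thesis by simp
    qed
    then have "openin ?Y (\<Union>n\<in>{..<N}. \<Union>h\<in>carrier G.
        {z \<in> topspace ?Y. \<forall>d\<in>D n. z (d \<otimes> \<gamma> n \<otimes> h) = z (d \<otimes> h)})" by blast
    moreover have "topspace ?Y - S N = (\<Union>n\<in>{..<N}. \<Union>h\<in>carrier G.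
        {z \<in> topspace ?Y. \<forall>d\<in>D n. z (d \<otimes> \<gamma> n \<otimes> h) = z (d \<otimes> h)})"
      unfolding S_def by blast
    moreover have "S N \<subseteq> topspace ?Y" by (auto simp: S_def)
    ultimately show ?thesis by (simp add: closedin_def)
  qed
  define S_all where "S_all = (\<Inter>N. S N)"
  have Sinf_closed: "closedin ?Y S_all" unfolding S_all_def using S_closed by blast
  have Sinf_top: "S_all \<subseteq> topspace ?Y" using Sinf_closed closedin_subset by blast
  have Sinf_free: "S_all \<subseteq> free_part G"
  proof
    fix z assume z: "z \<in> S_all"
    have "g = \<one>" if g: "g \<in> carrier G" "shift_action G g z = z" for g
    proof (rule ccontr)
      assume "g \<noteq> \<one>"
      then obtain n where n: "g = \<gamma> n" using g rg by blast
      have "z \<in> S (Suc n)" using z by (auto simp: S_all_def)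
      then have "\<exists>d\<in>D n. z (d \<otimes> \<gamma> n \<otimes> \<one>) \<noteq> z (d \<otimes> \<one>)" unfolding S_def by blast
      then obtain d where d: "d \<in> D n" "z (d \<otimes> \<gamma> n) \<noteq> z d" using DG gam by auto
      then show False
        using shift_action_apply[of z G d g] DG[OF d(1)] g(2) Sinf_top z n by auto
    qed
    then show "z \<in> free_part G" using z Sinf_top by (auto simp: free_part_iff)
  qed
  have Sinf_shift: "shift_action G g z \<in> S_all" if g: "g \<in> carrier G" and z: "z \<in> S_all" for g z
  proof -
    have zY: "z \<in> topspace ?Y" using z Sinf_top by auto
    have "shift_action G g z \<in> S N" for N
    proof -
      have "\<exists>d\<in>D n. shift_action G g z (d \<otimes> \<gamma> n \<otimes> h) \<noteq> shift_action G g z (d \<otimes> h)"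
        if n: "n < N" and h: "h \<in> carrier G" for n h
      proof -
        have "z \<in> S N" using z by (auto simp: S_all_def)
        then obtain d where d: "d \<in> D n" "z (d \<otimes> \<gamma> n \<otimes> (h \<otimes> g)) \<noteq> z (d \<otimes> (h \<otimes> g))"
          unfolding S_def using n h g by blast
        then show ?thesis
          using DG[OF d(1)] gam h g zY
          by (intro bexI[of _ d]) (simp_all add: shift_action_apply m_assoc)
      qed
      then show ?thesis using shift_closed[OF g zY] by (simp add: S_def)
    qed
    then show ?thesis by (simp add: S_all_def)
  qed

  \<comment> \<open>Small clopen sets on which \<open>f\<close> is constant within \<open>S_all\<close>: their index carries the extension \<open>f'\<close>.\<close>
  define R where "R U \<longleftrightarrow> (\<exists>v. \<forall>z\<in>U \<inter> S_all. f z = v)" for U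
  have nbhd: "\<exists>U. openin ?Y U \<and> z \<in> U \<and> R U" if z: "z \<in> topspace ?Y" for z
  proof (cases "z \<in> S_all")
    case True
    have "openin (free_part_space G) {y \<in> topspace (free_part_space G). f y = f z}"
      using locally_constant_from_discrete[OF f] unfolding locally_constant_iff by blast
    then obtain W where W: "openin ?Y W" "{y \<in> free_part G. f y = f z} = W \<inter> free_part G"
      unfolding topspace_free_part_space by (auto simp: free_part_space_def openin_subtopology)
    have "z \<in> W" using W(2) True Sinf_free by blast
    moreover have "R W" unfolding R_def using W(2) Sinf_free by blast
    ultimately show ?thesis using W(1) by blast
  next
    case False
    have "openin ?Y (topspace ?Y - S_all)" using Sinf_closed by (simp add: closedin_def)
    moreover have "R (topspace ?Y - S_all)" unfolding R_def by blast
    ultimately show ?thesis using False z by blast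
  qed
  have mono: "R V" if "R U" "V \<subseteq> U" for U V using that unfolding R_def by blast
  obtain i :: "('a \<Rightarrow> nat) \<Rightarrow> nat" and U where i: "locally_constant ?Y i"
    and iU: "\<And>z. z \<in> topspace ?Y \<Longrightarrow> z \<in> U (i z) \<and> R (U (i z))"
    by (rule clopen_indexing[OF zero_dimensional_shift_space compact_imp_Lindelof_space[OF compact_shift_space]
          nbhd mono]) blast+
  define v where "v n = (SOME v. \<forall>z\<in>U n \<inter> S_all. f z = v)" for n
  \<comment> \<open>Pieces disjoint from \<open>S_all\<close> have an arbitrary value \<open>v\<close>; it is cut off to stay below \<open>k\<close>.\<close>
  define f' where "f' z = (if v (i z) < k then v (i z) else 0)" for z
  have f'_lc: "locally_constant ?Y f'"
    unfolding f'_def by (rule locally_constant_comp[OF i, where h="\<lambda>n. if v n < k then v n else 0"])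
  have f'_less: "f' z < k" for z using k by (simp add: f'_def)
  have f'_eq: "f' z = f z" if z: "z \<in> S_all" for z
  proof -
    have zY: "z \<in> topspace ?Y" "z \<in> free_part G" using z Sinf_top Sinf_free by auto
    have "\<exists>v. \<forall>z\<in>U (i z) \<inter> S_all. f z = v" using iU[OF zY(1)] unfolding R_def by blast
    then have "\<forall>y\<in>U (i z) \<inter> S_all. f y = v (i z)" unfolding v_def by (rule someI_ex)
    then have "f z = v (i z)" using iU[OF zY(1)] z by blast
    moreover have "f z < k"
      using f zY(2) by (auto simp: continuous_map_def topspace_free_part_space)
    ultimately show ?thesis by (simp add: f'_def)
  qed

  define occ where "occ z \<longleftrightarrow> (\<exists>p\<in>P. \<forall>g\<in>dom p. p g = Some (f' (shift_action G g z)))" for z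
  have occ_lc: "locally_constant ?Y occ"
    unfolding occ_def
  proof (intro locally_constant_Bex finP locally_constant_Ball domP)
    fix p g assume pg: "p \<in> P" "g \<in> dom p"
    have "continuous_map ?Y ?Y (shift_action G g)"
      using gamma_space_shift domP[OF pg(1)] pg(2) by (auto simp: gamma_space_iff)
    from continuous_map_compose[OF this f'_lc]
    show "locally_constant ?Y (\<lambda>z. p g = Some (f' (shift_action G g z)))"
      using locally_constant_comp[of ?Y "f' \<circ> shift_action G g" "\<lambda>a. p g = Some a"] by (simp add: o_def)
  qed
  have not_occ: "\<not> occ z" if z: "z \<in> S_all" for z
  proof
    assume "occ z"
    then obtain p where p: "p \<in> P" "\<forall>g\<in>dom p. p g = Some (f' (shift_action G g z))"
      by (auto simp: occ_def)
    have "f' (shift_action G g z) = f (free_part_action G g z)" if "g \<in> dom p" for g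
      using that domP(2)[OF p(1)] f'_eq[OF Sinf_shift[OF _ z]] z Sinf_free
      by (auto simp: free_part_action_def)
    then have "occurs_in p (free_part_space G) (free_part_action G) f"
      unfolding occurs_in_def topspace_free_part_space using p z Sinf_free by (intro bexI[of _ z]) auto
    then show False using av p(1) by (auto simp: avoiding_def)
  qed
  obtain N where N: "\<And>z. z \<in> S N \<Longrightarrow> \<not> occ z"
  proof (rule ccontr)
    assume "\<not> thesis"
    then have bad: "\<exists>z\<in>S N. occ z" for N using that by blast
    have "(\<Inter>N. S N \<inter> {z \<in> topspace ?Y. occ z}) \<noteq> {}"
    proof (rule compact_space_imp_nest[OF compact_shift_space[of G]])
      have "closedin ?Y {z \<in> topspace ?Y. occ z}"
        using occ_lc locally_constant_clopen[of ?Y "Collect occ"] by (simp add: Int_def)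
      then show "closedin ?Y (S N \<inter> {z \<in> topspace ?Y. occ z})" for N
        using S_closed by (intro closedin_Int)
      show "S N \<inter> {z \<in> topspace ?Y. occ z} \<noteq> {}" for N
        using bad[of N] unfolding S_def by blast
      show "decseq (\<lambda>N. S N \<inter> {z \<in> topspace ?Y. occ z})"
        unfolding decseq_def S_def by auto
    qed
    then show False using not_occ unfolding S_all_def by blast
  qed

  obtain c :: "'x \<Rightarrow> bool" where c: "locally_constant X c"
    and csep: "\<forall>n<N. \<forall>x\<in>topspace X. \<exists>d\<in>D n. c (\<phi> (d \<otimes> \<gamma> n) x) \<noteq> c (\<phi> d x)"
    using sep[OF X] by metis
  define \<pi> where "\<pi> x = (\<lambda>d\<in>carrier G. if c (\<phi> d x) then 1 else 0 :: nat)" for x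
  have \<pi>_top: "\<pi> x \<in> topspace ?Y" for x by (auto simp: \<pi>_def topspace_shift_space)
  have \<pi>_S: "\<pi> x \<in> S N" if x: "x \<in> topspace X" for x
  proof -
    have "\<exists>d\<in>D n. \<pi> x (d \<otimes> \<gamma> n \<otimes> h) \<noteq> \<pi> x (d \<otimes> h)" if n: "n < N" and h: "h \<in> carrier G" for n h
    proof -
      obtain d where d: "d \<in> D n" "c (\<phi> (d \<otimes> \<gamma> n) (\<phi> h x)) \<noteq> c (\<phi> d (\<phi> h x))"
        using csep n X.act_closed[OF h x] by blast
      then show ?thesis
        using DG[OF d(1)] gam h x by (intro bexI[of _ d]) (auto simp: \<pi>_def X.act_mult)
    qed
    then show ?thesis using \<pi>_top by (simp add: S_def)
  qed
  have \<pi>_equiv: "\<pi> (\<phi> g x) = shift_action G g (\<pi> x)" if "g \<in> carrier G" "x \<in> topspace X" for g x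
    using that shift_closed[OF that(1) \<pi>_top]
    by (intro extensionalityI[of _ "carrier G"])
      (auto simp: shift_action_apply[OF \<pi>_top] topspace_shift_space PiE_def, auto simp: \<pi>_def X.act_mult)
  have \<pi>_cont: "continuous_map X ?Y \<pi>"
    unfolding shift_space_def continuous_map_componentwise
  proof (intro conjI ballI)
    fix d assume d: "d \<in> carrier G"
    have "locally_constant X (\<lambda>x. if c (\<phi> d x) then 1 else 0 :: nat)"
      by (rule locally_constant_comp[where h="\<lambda>b. if b then 1 else 0"]) (rule X.locally_constant_act[OF d c])
    then have "locally_constant X (\<lambda>x. \<pi> x d)"
      by (rule locally_constant_cong) (simp add: \<pi>_def d)
    then show "continuous_map X (discrete_topology {..<2}) (\<lambda>x. \<pi> x d)"
      by (rule locally_constant_into) (use d in \<open>auto simp: \<pi>_def\<close>)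
  qed (auto simp: \<pi>_def)
  have "continuous_map X (discrete_topology {..<k}) (f' \<circ> \<pi>)"
    by (rule locally_constant_into[OF continuous_map_compose[OF \<pi>_cont f'_lc]]) (simp add: f'_less)
  moreover have "avoiding P X \<phi> (f' \<circ> \<pi>)"
    unfolding avoiding_def
  proof (intro ballI notI)
    fix p assume p: "p \<in> P" and "occurs_in p X \<phi> (f' \<circ> \<pi>)"
    then obtain x where x: "x \<in> topspace X" "\<forall>g\<in>dom p. p g = Some (f' (\<pi> (\<phi> g x)))"
      by (auto simp: occurs_in_def)
    then have "\<forall>g\<in>dom p. p g = Some (f' (shift_action G g (\<pi> x)))"
      using domP(2)[OF p] \<pi>_equiv by (metis subsetD)
    then have "occ (\<pi> x)" using p unfolding occ_def by blast
    then show False using N \<pi>_S[OF x(1)] by blast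
  qed
  ultimately show ?thesis unfolding admits_continuous_avoiding_coloring_def by blast
qed

end

theorem theorem1p12:
  fixes \<Gamma> :: "('g, 'm) monoid_scheme"
    and k :: nat
    and P :: "('g \<rightharpoonup> nat) set"
  assumes "group \<Gamma>"
    and "countable (carrier \<Gamma>)"
    and "infinite (carrier \<Gamma>)"
    and "k \<ge> 1"
    and "finite P"
    and "\<forall>p\<in>P. is_pattern \<Gamma> k p"
  shows "(admits_continuous_avoiding_coloring k P (free_part_space \<Gamma>) (free_part_action \<Gamma>)
            \<longleftrightarrow> all_free_zd_Polish_spaces_admit TYPE(real) \<Gamma> k P) \<and>
         (admits_continuous_avoiding_coloring k P (free_part_space \<Gamma>) (free_part_action \<Gamma>)
            \<longrightarrow> all_free_zd_Polish_spaces_admit TYPE('x) \<Gamma> k P)"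
proof -
  interpret group \<Gamma> by fact
  let ?A = "admits_continuous_avoiding_coloring k P (free_part_space \<Gamma>) (free_part_action \<Gamma>)"
  have "all_free_zd_Polish_spaces_admit TYPE(real) \<Gamma> k P" if ?A
    unfolding all_free_zd_Polish_spaces_admit_def
    by (intro allI impI admits_if_admits_free_part[OF assms(2-6) that] free_zd_gspaceI)
  moreover have "all_free_zd_Polish_spaces_admit TYPE('x) \<Gamma> k P" if ?A
    unfolding all_free_zd_Polish_spaces_admit_def
    by (intro allI impI admits_if_admits_free_part[OF assms(2-6) that] free_zd_gspaceI)
  moreover have ?A if "all_free_zd_Polish_spaces_admit TYPE(real) \<Gamma> k P"
    by (rule admits_free_part_if_all_real[OF assms(2,3,6) that])
  ultimately show ?thesis by blast
qed

end
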